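(* Let $K$ be a closed subset of $G$. Then for any $f\in\mathcal{L}(\mathcal{X}_K)$, any $x_{P(K)}\in\mathcal{X}_{P(K)}$, any $h\in\mathcal{L}(\mathcal{X}_{N(K)})$ and any non-negative $g\in\mathcal{L}(\mathcal{X}_{N'(K)})$: $$\underline{E}^{\mathrm{irr}}_G\Big(h(X_{N(K)})+g(X_{N'(K)})\,\mathbb{I}_{x_{P(K)}}(X_{P(K)})\,f(X_K)\Big)=\underline{E}^{\mathrm{irr}}_{N(K)}\Big(h(X_{N(K)})+g(X_{N'(K)})\,\mathbb{I}_{x_{P(K)}}(X_{P(K)})\,\underline{E}^{\mathrm{irr}}_{K\mid x_{P(K)}}\big(f(X_K)\big)\Big).$$
   Context: Setting: $G$ is a finite set of nodes forming a DAG; node $s$ carries a variable $X_s$ with finite nonempty state space $\mathcal{X}_s$; $\mathcal{X}_S=\times_{s\in S}\mathcal{X}_s$; $\mathcal{L}(\mathcal{X}_S)$ is the set of real-valued functions on $\mathcal{X}_S$. $\mathbb{I}_{x_{P(K)}}$ is the indicator of $\{x_{P(K)}\}$. $P(s)$: parents; $s\sqsubseteq v$: directed path (possibly trivial) from $s$ to $v$; $s\sqsubset v$: additionally $s\neq v$; $D(s)=\{v:s\sqsubset v\}$; $N(s)=G\setminus(\{s\}\cup D(s))$. For $K\subseteq G$: $P(K)=(\bigcup_{s\in K}P(s))\setminus K$, $D(K)=(\bigcup_{s\in K}D(s))\setminus K$, $N(K)=G\setminus(K\cup D(K))$, $N'(K)=N(K)\setminus P(K)$; $K$ is closed if $s\sqsubseteq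 k\sqsubseteq t$ with $s,t\in K$ implies $k\in K$. Local models: nonempty closed convex sets $\mathcal{M}_{s\mid x_{P(s)}}$ of probability mass functions on $\mathcal{X}_s$. Full conditional probability measure on finite $\Omega$: $(A,B)\mapsto P(A\mid B)$ ($B\ne\emptyset$), (F1) $P(\cdot\mid B)$ a probability measure with $P(B\mid B)=1$, (F2) $P(A\cap C\mid B)=P(A\mid C\cap B)P(C\mid B)$ if $C\cap B\neq\emptyset$. Irrelevant natural extension $\mathcal{F}^{\mathrm{irr}}_G$: all full conditional probability measures $P$ on $\mathcal{X}_G$ with $P(X_s\mid x_{N(s)})\in\mathcal{M}_{s\mid x_{P(s)}}$ for all $s, x_{N(s)}$. $\underline{E}^{\mathrm{irr}}_G(f(X_G))=\inf\{\sum_{z_G}f(z_G)P(z_G):P\in\mathcal{F}^{\mathrm{irr}}_G\}$. Sub-network: for $K\subseteq G$ and fixed $x_{P(K)}$, the credal network on the DAG restricted to $K$ with local credal sets $\mathcal{M}_{s\mid(z_{P(s)\cap K},x_{P(s)\setminus K})}$; its irrelevant-natural-extension lower expectation is $\underline{E}^{\mathrm{irr}}_{K\mid x_{P(K)}}$, written $\underline{E}^{\mathrm{irr}}_K$ when $P(K)=\emptyset$ (in particular $\underline{E}^{\mathrm{irr}}_{N(K)}$, since $N(K)$ has no parents outside itself). Upper expectations: $\overline{E}(f)=-\underline{E}(-f)$. *)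

theory Defs
  imports "HOL-Analysis.Analysis"
begin

text \<open>Credal networks. Nodes have type 'n, states type 'v. The DAG is given by a parent
  map par :: 'n => 'n set; X s is the state space of node s; joint assignments on a node
  set S are the extensional functions in PiE S X. M s u is the local credal set of node s
  given the parent assignment u (an element of PiE (par s) X). Mass functions on X s are
  functions 'v => real vanishing outside X s.\<close>

definition pmf_on :: "'v set \<Rightarrow> ('v \<Rightarrow> real) \<Rightarrow> bool" where
  "pmf_on A p \<longleftrightarrow> (\<forall>v\<in>A. 0 \<le> p v) \<and> (\<forall>v. v \<notin> A \<longrightarrow> p v = 0) \<and> sum p A = 1"

definition convex_fun_set :: "('v \<Rightarrow> real) set \<Rightarrow> bool" where
  "convex_fun_set C \<longleftrightarrow>
     (\<forall>p\<in>C. \<forall>q\<in>C. \<forall>t::real. 0 \<le> t \<and> t \<le> 1 \<longrightarrow> (\<lambda>v. t * p v + (1 - t) * q v) \<in> C)"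

definition full_cond_prob :: "'a set \<Rightarrow> ('a set \<Rightarrow> 'a set \<Rightarrow> real) \<Rightarrow> bool" where
  "full_cond_prob \<Omega> P \<longleftrightarrow>
     (\<forall>B. B \<subseteq> \<Omega> \<and> B \<noteq> {} \<longrightarrow>
        (\<forall>A. A \<subseteq> \<Omega> \<longrightarrow> 0 \<le> P A B) \<and> P \<Omega> B = 1 \<and>
        (\<forall>A C. A \<subseteq> \<Omega> \<and> C \<subseteq> \<Omega> \<and> A \<inter> C = {} \<longrightarrow> P (A \<union> C) B = P A B + P C B) \<and>
        P B B = 1) \<and>
     (\<forall>A B C. A \<subseteq> \<Omega> \<and> B \<subseteq> \<Omega> \<and> C \<subseteq> \<Omega> \<and> C \<inter> B \<noteq> {} \<longrightarrow>
        P (A \<inter> C) B = P A (C \<inter> B) * P C B)"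

definition edges_on :: "('n \<Rightarrow> 'n set) \<Rightarrow> 'n set \<Rightarrow> ('n \<times> 'n) set" where
  "edges_on par S = {(p, s). s \<in> S \<and> p \<in> S \<and> p \<in> par s}"

definition desc_on :: "('n \<Rightarrow> 'n set) \<Rightarrow> 'n set \<Rightarrow> 'n \<Rightarrow> 'n set" where
  "desc_on par S s = {v. (s, v) \<in> (edges_on par S)\<^sup>+}"

definition nondesc_on :: "('n \<Rightarrow> 'n set) \<Rightarrow> 'n set \<Rightarrow> 'n \<Rightarrow> 'n set" where
  "nondesc_on par S s = S - ({s} \<union> desc_on par S s)"

definition parents_set :: "('n \<Rightarrow> 'n set) \<Rightarrow> 'n set \<Rightarrow> 'n set" where
  "parents_set par K = (\<Union>s\<in>K. par s) - K"

definition desc_set :: "('n \<Rightarrow> 'n set) \<Rightarrow> 'n set \<Rightarrow> 'n set \<Rightarrow> 'n set" where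
  "desc_set par G K = (\<Union>s\<in>K. desc_on par G s) - K"

definition nondesc_set :: "('n \<Rightarrow> 'n set) \<Rightarrow> 'n set \<Rightarrow> 'n set \<Rightarrow> 'n set" where
  "nondesc_set par G K = G - (K \<union> desc_set par G K)"

definition nondesc_nonpar_set :: "('n \<Rightarrow> 'n set) \<Rightarrow> 'n set \<Rightarrow> 'n set \<Rightarrow> 'n set" where
  "nondesc_nonpar_set par G K = nondesc_set par G K - parents_set par K"

definition closed_nodes :: "('n \<Rightarrow> 'n set) \<Rightarrow> 'n set \<Rightarrow> 'n set \<Rightarrow> bool" where
  "closed_nodes par G K \<longleftrightarrow>
     (\<forall>s\<in>K. \<forall>t\<in>K. \<forall>k. (s, k) \<in> (edges_on par G)\<^sup>* \<and> (k, t) \<in> (edges_on par G)\<^sup>* \<longrightarrow> k \<in> K)"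

text \<open>Irrelevant natural extension of the (sub-)network on node set S, where parents
  outside S are fixed to the values of the assignment y.\<close>
definition irr_ext ::
  "('n \<Rightarrow> 'n set) \<Rightarrow> ('n \<Rightarrow> 'v set) \<Rightarrow> ('n \<Rightarrow> ('n \<Rightarrow> 'v) \<Rightarrow> ('v \<Rightarrow> real) set)
    \<Rightarrow> 'n set \<Rightarrow> ('n \<Rightarrow> 'v)
    \<Rightarrow> ((('n \<Rightarrow> 'v) set \<Rightarrow> ('n \<Rightarrow> 'v) set \<Rightarrow> real) set)" where
  "irr_ext par X M S y =
     {P. full_cond_prob (PiE S X) P \<and>
         (\<forall>s\<in>S. \<forall>z\<in>PiE S X.
            (\<lambda>v. P {w \<in> PiE S X. w s = v}
                   {w \<in> PiE S X. \<forall>t\<in>nondesc_on par S s. w t = z t})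
            \<in> M s (restrict (\<lambda>t. if t \<in> S then z t else y t) (par s)))}"

definition lower_exp_irr ::
  "('n \<Rightarrow> 'n set) \<Rightarrow> ('n \<Rightarrow> 'v set) \<Rightarrow> ('n \<Rightarrow> ('n \<Rightarrow> 'v) \<Rightarrow> ('v \<Rightarrow> real) set)
    \<Rightarrow> 'n set \<Rightarrow> ('n \<Rightarrow> 'v) \<Rightarrow> (('n \<Rightarrow> 'v) \<Rightarrow> real) \<Rightarrow> real" where
  "lower_exp_irr par X M S y f =
     Inf {(\<Sum>z\<in>PiE S X. f z * P {z} (PiE S X)) | P. P \<in> irr_ext par X M S y}"

end

(* One inequality: for P in the extension of G, the marginal on N(K) and the conditional measures
   on K given the value of X_N(K) lie in the extensions of the subnetworks, because they are convex
   mixtures of conditionals of P on finer events.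

   The other inequality: given measures on N(K) and on K, approximate both by strictly positive ones,
   multiply them (with arbitrary local models for the remaining nodes, and for the nodes of K below a
   parent of K deviating from x), and let a subsequence of the conditional probabilities of the
   product converge. In the positive products every conditional of X_s given X_N(s) is a conditional
   of one of the factors, so the limit lies in the extension of G, null events included. *)

theory Submission
  imports Defs
begin

section \<open>Full conditional probability measures on a finite space\<close>

text \<open>Membership in the extension constrains the conditional of \<open>X_s\<close> on every
  event \<open>X_N(s) = x_N(s)\<close>, including events of probability zero. A product of the
  unconditional measures on N(K) and K says nothing about those, so the gluing takes place among
  strictly positive weights, where each conditional is a quotient with cancelling factors. The
  approximations are chosen so that all conditionals converge, on null events too. The measure on K
  belongs to the one parent value x. Letting all of K change to other models as soon as
  \<open>X_P(K)\<close> differs from x would be wrong: a node p of P(K) can have a nondescendant k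
  in K, and \<open>X_k\<close> would then carry information about \<open>X_p\<close>. The change is
  therefore made node by node, and whether it happens at k depends only on proper ancestors of k.
  Non-negativity of g enters both inequalities: it keeps the direction when the expectation of f
  under a measure on K is compared with its infimum.\<close>

lemma fcp_nonneg:
  "\<lbrakk>full_cond_prob \<Omega> P; A \<subseteq> \<Omega>; B \<subseteq> \<Omega>; B \<noteq> {}\<rbrakk> \<Longrightarrow> 0 \<le> P A B"
  unfolding full_cond_prob_def by blast

lemma fcp_self:
  "\<lbrakk>full_cond_prob \<Omega> P; B \<subseteq> \<Omega>; B \<noteq> {}\<rbrakk> \<Longrightarrow> P B B = 1"
  unfolding full_cond_prob_def by blast

lemma fcp_union:
  "\<lbrakk>full_cond_prob \<Omega> P; A \<subseteq> \<Omega>; C \<subseteq> \<Omega>; A \<inter> C = {}; B \<subseteq> \<Omega>; B \<noteq> {}\<rbrakk>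
    \<Longrightarrow> P (A \<union> C) B = P A B + P C B"
  unfolding full_cond_prob_def by blast

lemma fcp_mult:
  assumes "full_cond_prob \<Omega> P" "A \<subseteq> \<Omega>" "B \<subseteq> \<Omega>" "C \<subseteq> \<Omega>" "C \<inter> B \<noteq> {}"
  shows "P (A \<inter> C) B = P A (C \<inter> B) * P C B"
  using assms(1)[unfolded full_cond_prob_def, THEN conjunct2, rule_format, of A B C] assms(2-) by simp

lemma fcp_empty:
  assumes "full_cond_prob \<Omega> P" "B \<subseteq> \<Omega>" "B \<noteq> {}"
  shows "P {} B = 0"
  using fcp_union[OF assms(1), of "{}" "{}" B] assms by simp

lemma fcp_Int:
  assumes "full_cond_prob \<Omega> P" "A \<subseteq> \<Omega>" "B \<subseteq> \<Omega>" "B \<noteq> {}"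
  shows "P A B = P (A \<inter> B) B"
  using fcp_mult[OF assms(1,2,3,3)] fcp_self[OF assms(1,3,4)] assms(4) by simp

lemma fcp_cong:
  assumes "full_cond_prob \<Omega> P" "A \<subseteq> \<Omega>" "A' \<subseteq> \<Omega>" "B \<subseteq> \<Omega>" "B \<noteq> {}" "A \<inter> B = A' \<inter> B"
  shows "P A B = P A' B"
  using fcp_Int[OF assms(1,2,4,5)] fcp_Int[OF assms(1,3,4,5)] assms(6) by simp

lemma fcp_chain:
  assumes "full_cond_prob \<Omega> P" "A \<subseteq> C" "C \<subseteq> B" "B \<subseteq> \<Omega>" "C \<noteq> {}"
  shows "P A B = P A C * P C B"
proof -
  have "A \<inter> C = A" "C \<inter> B = C" "A \<subseteq> \<Omega>" "C \<subseteq> \<Omega>" using assms by auto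
  then show ?thesis using fcp_mult[OF assms(1), of A B C] assms by simp
qed

lemma fcp_UN:
  assumes P: "full_cond_prob \<Omega> P" and B: "B \<subseteq> \<Omega>" "B \<noteq> {}" and "finite I"
    and "\<And>i. i \<in> I \<Longrightarrow> F i \<subseteq> \<Omega>" "\<And>i j. \<lbrakk>i \<in> I; j \<in> I; i \<noteq> j\<rbrakk> \<Longrightarrow> F i \<inter> F j = {}"
  shows "P (\<Union>i\<in>I. F i) B = (\<Sum>i\<in>I. P (F i) B)"
  using assms(4-)
proof (induction I rule: finite_induct)
  case empty
  then show ?case using fcp_empty[OF P B] by simp
next
  case (insert i I)
  have "P (F i \<union> (\<Union>i\<in>I. F i)) B = P (F i) B + P (\<Union>i\<in>I. F i) B"
  proof (rule fcp_union[OF P _ _ _ B])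
    show "F i \<subseteq> \<Omega>" "(\<Union>i\<in>I. F i) \<subseteq> \<Omega>" using insert.prems(1) by auto
    have "F i \<inter> F j = {}" if "j \<in> I" for j
      using insert.prems(2)[of i j] insert.hyps that by auto
    then show "F i \<inter> (\<Union>i\<in>I. F i) = {}" by auto
  qed
  then show ?case using insert by simp
qed

lemma fcp_sum:
  assumes "full_cond_prob \<Omega> P" "finite \<Omega>" "A \<subseteq> \<Omega>" "B \<subseteq> \<Omega>" "B \<noteq> {}"
  shows "P A B = (\<Sum>a\<in>A. P {a} B)"
  using fcp_UN[OF assms(1,4,5), of A "\<lambda>a. {a}"] assms(2,3) by (auto dest: finite_subset)

lemma fcp_le_1:
  assumes "full_cond_prob \<Omega> P" "A \<subseteq> \<Omega>" "B \<subseteq> \<Omega>" "B \<noteq> {}"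
  shows "P A B \<le> 1"
proof -
  have "P (A \<inter> B \<union> (B - A)) B = P (A \<inter> B) B + P (B - A) B"
    by (rule fcp_union[OF assms(1)]) (use assms in auto)
  moreover have "A \<inter> B \<union> (B - A) = B" by auto
  moreover have "0 \<le> P (B - A) B" by (rule fcp_nonneg[OF assms(1)]) (use assms in auto)
  ultimately show ?thesis using fcp_Int[OF assms] fcp_self[OF assms(1,3,4)] by simp
qed

text \<open>The level sets of \<open>\<phi>\<close> partition \<open>B\<close>, and the product rule
  splits each piece. A null cell still has a conditional measure, but enters with weight
  zero.\<close>

lemma fcp_mixture:
  assumes P: "full_cond_prob \<Omega> P" and fin: "finite \<Omega>" and A: "A \<subseteq> \<Omega>" and B: "B \<subseteq> \<Omega>" "B \<noteq> {}"
  shows "P A B = (\<Sum>i\<in>\<phi> ` B. P {w\<in>B. \<phi> w = i} B * P A {w\<in>B. \<phi> w = i})"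
proof -
  have finB: "finite B" using B fin finite_subset by auto
  have "A \<inter> B = (\<Union>i\<in>\<phi> ` B. A \<inter> {w\<in>B. \<phi> w = i})" by auto
  then have "P A B = P (\<Union>i\<in>\<phi> ` B. A \<inter> {w\<in>B. \<phi> w = i}) B"
    using fcp_Int[OF P A B] by simp
  also have "\<dots> = (\<Sum>i\<in>\<phi> ` B. P (A \<inter> {w\<in>B. \<phi> w = i}) B)"
    by (rule fcp_UN[OF P B]) (use finB A in auto)
  also have "\<dots> = (\<Sum>i\<in>\<phi> ` B. P {w\<in>B. \<phi> w = i} B * P A {w\<in>B. \<phi> w = i})"
  proof (rule sum.cong[OF refl])
    fix i assume i: "i \<in> \<phi> ` B"
    have *: "{w\<in>B. \<phi> w = i} \<inter> B = {w\<in>B. \<phi> w = i}" by auto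
    have "P (A \<inter> {w\<in>B. \<phi> w = i}) B = P A ({w\<in>B. \<phi> w = i} \<inter> B) * P {w\<in>B. \<phi> w = i} B"
      by (rule fcp_mult[OF P A B(1)]) (use i B in auto)
    then show "P (A \<inter> {w\<in>B. \<phi> w = i}) B = P {w\<in>B. \<phi> w = i} B * P A {w\<in>B. \<phi> w = i}"
      unfolding * by (simp add: mult.commute)
  qed
  finally show ?thesis .
qed

text \<open>\<open>J\<close> stands for taking preimages under a map from a subset of
  \<open>\<Omega>\<close> onto \<open>\<Omega>'\<close>. As \<open>J \<Omega>'\<close> may be
  smaller than \<open>\<Omega>\<close>, this covers restriction to a subset as well as conditioning
  on a cylinder followed by projection. Onto is what keeps conditioning events nonempty.\<close>

lemma fcp_pullback:
  assumes P: "full_cond_prob \<Omega> P"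
    and J: "\<And>A. A \<subseteq> \<Omega>' \<Longrightarrow> J A \<subseteq> \<Omega>" "\<And>B. \<lbrakk>B \<subseteq> \<Omega>'; B \<noteq> {}\<rbrakk> \<Longrightarrow> J B \<noteq> {}"
      "\<And>A C. J (A \<union> C) = J A \<union> J C" "\<And>A C. J (A \<inter> C) = J A \<inter> J C" "J {} = {}"
  shows "full_cond_prob \<Omega>' (\<lambda>A B. P (J A) (J B))"
proof -
  have sub: "J A \<subseteq> \<Omega>" if "A \<subseteq> \<Omega>'" for A by (rule J(1)[OF that])
  have one: "P (J \<Omega>') (J B) = 1" if B: "B \<subseteq> \<Omega>'" "B \<noteq> {}" for B
  proof -
    have "J \<Omega>' \<inter> J B = J (\<Omega>' \<inter> B)" by (rule J(4)[symmetric])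
    also have "\<Omega>' \<inter> B = B" using B by auto
    finally show ?thesis
      using fcp_Int[OF P sub[OF order_refl] sub[OF B(1)] J(2)[OF B]] fcp_self[OF P sub[OF B(1)] J(2)[OF B]]
      by (simp only:)
  qed
  show ?thesis
    unfolding full_cond_prob_def
  proof (intro conjI allI impI)
    fix A B C
    assume *: "A \<subseteq> \<Omega>' \<and> B \<subseteq> \<Omega>' \<and> C \<subseteq> \<Omega>' \<and> C \<inter> B \<noteq> {}"
    then have "J C \<inter> J B \<noteq> {}" using J(2)[of "C \<inter> B"] J(4)[of C B] by blast
    then have "P (J A \<inter> J C) (J B) = P (J A) (J C \<inter> J B) * P (J C) (J B)"
      using * by (intro fcp_mult[OF P] sub) blast+
    then show "P (J (A \<inter> C)) (J B) = P (J A) (J (C \<inter> B)) * P (J C) (J B)"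
      using J(4)[of A C] J(4)[of C B] by (simp only:)
  next
    fix B A C assume *: "B \<subseteq> \<Omega>' \<and> B \<noteq> {}" "A \<subseteq> \<Omega>' \<and> C \<subseteq> \<Omega>' \<and> A \<inter> C = {}"
    then have "J A \<inter> J C = {}" using J(4)[of A C] J(5) by (simp only:)
    then have "P (J A \<union> J C) (J B) = P (J A) (J B) + P (J C) (J B)"
      using * by (intro fcp_union[OF P] sub J(2)) blast+
    then show "P (J (A \<union> C)) (J B) = P (J A) (J B) + P (J C) (J B)"
      using J(3)[of A C] by (simp only:)
  next
    fix A B assume "B \<subseteq> \<Omega>' \<and> B \<noteq> {}"
    then have B: "B \<subseteq> \<Omega>'" "B \<noteq> {}" by auto
    show "P (J \<Omega>') (J B) = 1" by (rule one[OF B])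
    show "P (J B) (J B) = 1" by (rule fcp_self[OF P sub[OF B(1)] J(2)[OF B]])
    assume "A \<subseteq> \<Omega>'"
    then show "0 \<le> P (J A) (J B)" by (intro fcp_nonneg[OF P sub sub[OF B(1)] J(2)[OF B]])
  qed
qed

section \<open>Approximation by strictly positive weights, and limits of such weights\<close>

text \<open>Convergence is demanded for every nonempty \<open>B\<close>, also where \<open>P\<close>
  gives \<open>B\<close> mass zero; pointwise convergence of the masses would lose these
  conditionals. Only quotients occur, so the weights need not be normalised.\<close>

definition positive_approx ::
  "'a set \<Rightarrow> ('a set \<Rightarrow> 'a set \<Rightarrow> real) \<Rightarrow> (nat \<Rightarrow> 'a \<Rightarrow> real) \<Rightarrow> bool" where
  "positive_approx \<Omega> P w \<longleftrightarrow> (\<forall>n. \<forall>a\<in>\<Omega>. 0 < w n a) \<and>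
     (\<forall>A B. A \<subseteq> \<Omega> \<and> B \<subseteq> \<Omega> \<and> B \<noteq> {} \<longrightarrow>
        (\<lambda>n. sum (w n) (A \<inter> B) / sum (w n) B) \<longlonglongrightarrow> P A B)"

lemma positive_approx_pos: "\<lbrakk>positive_approx \<Omega> P w; a \<in> \<Omega>\<rbrakk> \<Longrightarrow> 0 < w n a"
  by (simp add: positive_approx_def)

lemma positive_approx_lim:
  "\<lbrakk>positive_approx \<Omega> P w; A \<subseteq> \<Omega>; B \<subseteq> \<Omega>; B \<noteq> {}\<rbrakk>
    \<Longrightarrow> (\<lambda>n. sum (w n) (A \<inter> B) / sum (w n) B) \<longlonglongrightarrow> P A B"
  by (simp add: positive_approx_def)

text \<open>Every full conditional probability measure is a limit of strictly positive ones: below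
  the support of the unconditional measure put infinitesimally small copies of the measures that
  \<open>P\<close> assigns to the successive null layers.\<close>

lemma fcp_positive_approx_exists:
  assumes "finite \<Omega>" "full_cond_prob \<Omega> P"
  shows "\<exists>w. positive_approx \<Omega> P w"
  using assms
proof (induction "card \<Omega>" arbitrary: \<Omega> rule: less_induct)
  case less
  note fin = less.prems(1) and P = less.prems(2)
  show ?case
  proof (cases "\<Omega> = {}")
    case True
    then show ?thesis by (auto simp: positive_approx_def)
  next
    case ne: False
    define p where "p a = P {a} \<Omega>" for a
    define Z where "Z = {a\<in>\<Omega>. p a = 0}"
    have sum_p: "P A \<Omega> = sum p A" if "A \<subseteq> \<Omega>" for A
      unfolding p_def using fcp_sum[OF P fin that _ ne] by simp
    have p_nonneg: "0 \<le> p a" if "a \<in> \<Omega>" for a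
      unfolding p_def using fcp_nonneg[OF P, of "{a}" \<Omega>] that by auto
    have "sum p \<Omega> = 1" using sum_p[of \<Omega>] fcp_self[OF P _ ne] by simp
    moreover have "sum p Z = 0" unfolding Z_def by (intro sum.neutral) simp
    moreover have "Z \<subseteq> \<Omega>" unfolding Z_def by simp
    ultimately have "Z \<subset> \<Omega>" by auto
    then have "card Z < card \<Omega>" using fin psubset_card_mono by blast
    moreover have "finite Z" using fin unfolding Z_def by simp
    \<comment> \<open>The null set keeps its own conditional measures, so \<open>P\<close> itself,
      read on subsets of \<open>Z\<close>, serves for the induction.\<close>
    moreover have "full_cond_prob Z P"
      by (rule fcp_pullback[OF P, of Z "\<lambda>A. A"]) (use \<open>Z \<subseteq> \<Omega>\<close> in blast)+
    ultimately obtain w where w: "positive_approx Z P w" using less.hyps by blast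
    note w_pos = positive_approx_pos[OF w] and w_lim = positive_approx_lim[OF w]
    \<comment> \<open>Dividing by \<open>1 + sum (w n) Z\<close> bounds each scaled weight by
      \<open>1 / Suc n\<close> although \<open>w\<close> is not normalised, so the layer on
      \<open>Z\<close> becomes negligible against \<open>p\<close>.\<close>
    define c where "c n = 1 / (real (Suc n) * (1 + sum (w n) Z))" for n
    define w' where "w' n a = (if a \<in> Z then c n * w n a else p a)" for n a
    have sumw: "0 \<le> sum (w n) Z" for n by (intro sum_nonneg less_imp_le w_pos)
    have c_pos: "0 < c n" for n unfolding c_def using sumw[of n] by (intro divide_pos_pos mult_pos_pos) simp_all
    have pos: "0 < w' n a" if "a \<in> \<Omega>" for n a
      using that c_pos[of n] w_pos[of a n] p_nonneg[OF that] unfolding w'_def Z_def by (cases "p a = 0") auto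
    have w'_lim: "(\<lambda>n. w' n a) \<longlonglongrightarrow> p a" if "a \<in> \<Omega>" for a
    proof (cases "a \<in> Z")
      case True
      have "c n * w n a \<le> 1 / real (Suc n)" for n
      proof -
        have "w n a \<le> sum (w n) Z"
          by (rule member_le_sum) (use True w_pos[THEN less_imp_le] \<open>finite Z\<close> in auto)
        then have "w n a / (1 + sum (w n) Z) \<le> 1" using sumw[of n] by simp
        then have "w n a / (1 + sum (w n) Z) * (1 / real (Suc n)) \<le> 1 * (1 / real (Suc n))"
          by (intro mult_right_mono) auto
        then show ?thesis unfolding c_def by (simp add: mult.commute)
      qed
      moreover have "0 \<le> c n * w n a" for n using c_pos w_pos[OF True] by (simp add: less_imp_le)
      ultimately have "(\<lambda>n. c n * w n a) \<longlonglongrightarrow> 0"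
        by (intro real_tendsto_sandwich[OF _ _ tendsto_const LIMSEQ_inverse_real_of_nat])
           (simp_all add: inverse_eq_divide)
      then show ?thesis using True unfolding w'_def Z_def by simp
    qed (simp add: w'_def)
    have lim: "(\<lambda>n. sum (w' n) (A \<inter> B) / sum (w' n) B) \<longlonglongrightarrow> P A B"
      if "A \<subseteq> \<Omega>" "B \<subseteq> \<Omega>" "B \<noteq> {}" for A B
    \<comment> \<open>Inside \<open>Z\<close> the scale \<open>c n\<close> cancels and the inductive
      approximation remains; otherwise \<open>B\<close> has positive mass and its conditionals are
      determined by \<open>p\<close>.\<close>
    proof (cases "B \<subseteq> Z")
      case True
      have "sum (w' n) (A \<inter> B) / sum (w' n) B = sum (w n) ((A \<inter> Z) \<inter> B) / sum (w n) B" for n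
      proof -
        have "sum (w' n) (A \<inter> B) = c n * sum (w n) (A \<inter> B)" "sum (w' n) B = c n * sum (w n) B"
          unfolding sum_distrib_left by (rule sum.cong; use True in \<open>auto simp: w'_def\<close>)+
        moreover have "(A \<inter> Z) \<inter> B = A \<inter> B" using True by auto
        ultimately show ?thesis using c_pos[of n] by simp
      qed
      moreover have "P A B = P (A \<inter> Z) B"
        by (rule fcp_cong[OF P]) (use that True in auto)
      ultimately show ?thesis using w_lim[of "A \<inter> Z" B] True that by simp
    next
      case False
      then obtain b where b: "b \<in> B" "b \<notin> Z" by blast
      then have "p b > 0" using that p_nonneg[of b] unfolding Z_def by (auto simp: less_le)
      have "finite B" using that fin finite_subset by auto
      then have B_pos: "0 < sum p B"
        using b(1) \<open>p b > 0\<close> that p_nonneg by (intro sum_pos2[of B b]) auto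
      have "P (A \<inter> B) \<Omega> = P A (B \<inter> \<Omega>) * P B \<Omega>"
        by (rule fcp_mult[OF P]) (use that in auto)
      then have "P A B = sum p (A \<inter> B) / sum p B"
        using sum_p[of B] sum_p[of "A \<inter> B"] that B_pos inf.absorb1[of B \<Omega>] by (simp add: le_infI1)
      moreover have "(\<lambda>n. sum (w' n) (A \<inter> B) / sum (w' n) B) \<longlonglongrightarrow> sum p (A \<inter> B) / sum p B"
      proof (rule tendsto_divide)
        have "(\<lambda>n. sum (w' n) C) \<longlonglongrightarrow> sum p C" if "C \<subseteq> \<Omega>" for C
          by (intro tendsto_sum w'_lim) (use that in auto)
        then show "(\<lambda>n. sum (w' n) (A \<inter> B)) \<longlonglongrightarrow> sum p (A \<inter> B)" "(\<lambda>n. sum (w' n) B) \<longlonglongrightarrow> sum p B"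
          using that by (simp_all add: le_infI1)
      qed (use B_pos in simp)
      ultimately show ?thesis by simp
    qed
    show ?thesis unfolding positive_approx_def using pos lim by blast
  qed
qed

text \<open>Dividing by the total changes no quotient. The pointwise limits are what later
  identifies the unconditional masses of the glued measure, which quotients within one factor do not
  give.\<close>

lemma fcp_positive_approx_normalised:
  assumes fin: "finite \<Omega>" and P: "full_cond_prob \<Omega> P"
  shows "\<exists>w. positive_approx \<Omega> P w \<and> (\<forall>a\<in>\<Omega>. (\<lambda>n. w n a) \<longlonglongrightarrow> P {a} \<Omega>)"
proof -
  obtain w where w: "positive_approx \<Omega> P w"
    using fcp_positive_approx_exists[OF fin P] by blast
  note pos = positive_approx_pos[OF w] and lim = positive_approx_lim[OF w]
  define u where "u n a = w n a / sum (w n) \<Omega>" for n a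
  have tot: "0 < sum (w n) \<Omega>" if "a \<in> \<Omega>" for n a
    using that pos fin by (intro sum_pos) auto
  have "0 < u n a" if "a \<in> \<Omega>" for n a
    unfolding u_def using that tot pos by (intro divide_pos_pos) auto
  moreover have "(\<lambda>n. sum (u n) (A \<inter> B) / sum (u n) B) \<longlonglongrightarrow> P A B"
    if "A \<subseteq> \<Omega>" "B \<subseteq> \<Omega>" "B \<noteq> {}" for A B
  proof -
    from that obtain b where "b \<in> \<Omega>" by auto
    then have "sum (u n) (A \<inter> B) / sum (u n) B = sum (w n) (A \<inter> B) / sum (w n) B" for n
      unfolding u_def using tot[of b n] by (simp flip: sum_divide_distrib)
    then show ?thesis using lim[OF that] by simp
  qed
  moreover have "(\<lambda>n. u n a) \<longlonglongrightarrow> P {a} \<Omega>" if "a \<in> \<Omega>" for a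
    unfolding u_def using lim[of "{a}" \<Omega>] that by auto
  ultimately show ?thesis unfolding positive_approx_def by blast
qed

lemma bounded_convergent_subseq_finite:
  fixes f :: "'i \<Rightarrow> nat \<Rightarrow> real"
  assumes "finite I" "\<And>i. i \<in> I \<Longrightarrow> bounded (range (f i))"
  shows "\<exists>r. strict_mono r \<and> (\<forall>i\<in>I. convergent (f i \<circ> r))"
  using assms
proof (induction I rule: finite_induct)
  case empty
  show ?case by (intro exI[of _ id]) (auto simp: strict_mono_def)
next
  case (insert i I)
  then obtain r where r: "strict_mono r" "\<forall>i\<in>I. convergent (f i \<circ> r)" by blast
  have "bounded (range (f i \<circ> r))"
    by (rule bounded_subset[OF insert.prems[of i]]) auto
  then obtain l r' where r': "strict_mono r'" "((f i \<circ> r) \<circ> r') \<longlonglongrightarrow> l"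
    using bounded_imp_convergent_subsequence by metis
  have "convergent (f j \<circ> (r \<circ> r'))" if "j \<in> insert i I" for j
  proof (cases "j = i")
    case True
    then show ?thesis using r'(2) by (auto simp: convergent_def o_assoc)
  next
    case False
    then show ?thesis using r r'(1) that convergent_subseq_convergent[of "f j \<circ> r" r']
      by (auto simp: o_assoc)
  qed
  then show ?case using r(1) r'(1) strict_mono_o by blast
qed

text \<open>There are finitely many pairs of events and all conditional probabilities lie in [0,1],
  so one subsequence makes all of them converge. The axioms are equations and weak inequalities
  between them and survive the limit; for positive weights the product rule is cancellation of the
  mass of \<open>C \<inter> B\<close>.\<close>

lemma fcp_limit_of_positive:
  fixes w :: "nat \<Rightarrow> 'a \<Rightarrow> real"
  assumes fin: "finite \<Omega>" and pos: "\<And>n a. a \<in> \<Omega> \<Longrightarrow> 0 < w n a"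
  shows "\<exists>P r. full_cond_prob \<Omega> P \<and> strict_mono r \<and> positive_approx \<Omega> P (\<lambda>n. w (r n))"
proof -
  define c where "c n A B = sum (w n) (A \<inter> B) / sum (w n) B" for n A B
  have finB: "finite B" if "B \<subseteq> \<Omega>" for B using that fin finite_subset by auto
  have sum_nn: "0 \<le> sum (w n) A" if "A \<subseteq> \<Omega>" for n A
    by (intro sum_nonneg less_imp_le pos) (use that in auto)
  have sum_p: "0 < sum (w n) B" if "B \<subseteq> \<Omega>" "B \<noteq> {}" for n B
    by (intro sum_pos) (use that pos finB in auto)
  have c_nn: "0 \<le> c n A B" if "B \<subseteq> \<Omega>" for n A B
    unfolding c_def using that by (intro divide_nonneg_nonneg sum_nn) auto
  have c_le: "c n A B \<le> 1" if "B \<subseteq> \<Omega>" for n A B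
  proof -
    have "sum (w n) (A \<inter> B) \<le> sum (w n) B"
      by (rule sum_mono2) (use that finB pos[THEN less_imp_le] in auto)
    then show ?thesis unfolding c_def using sum_nn[OF that, of n] by (auto simp: divide_le_eq_1)
  qed
  have "\<exists>r. strict_mono r \<and> (\<forall>i\<in>Pow \<Omega> \<times> Pow \<Omega>. convergent ((\<lambda>n. c n (fst i) (snd i)) \<circ> r))"
  proof (rule bounded_convergent_subseq_finite)
    fix i assume "i \<in> Pow \<Omega> \<times> Pow \<Omega>"
    then have "\<forall>n. norm (c n (fst i) (snd i)) \<le> 1" using c_nn c_le by auto
    then show "bounded (range (\<lambda>n. c n (fst i) (snd i)))"
      unfolding bounded_iff by auto
  qed (use fin in auto)
  then obtain r where r: "strict_mono r"
    and conv: "\<And>A B. \<lbrakk>A \<subseteq> \<Omega>; B \<subseteq> \<Omega>\<rbrakk> \<Longrightarrow> convergent (\<lambda>n. c (r n) A B)"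
    by (auto simp: o_def)
  define P where "P A B = lim (\<lambda>n. c (r n) A B)" for A B
  have P_lim: "(\<lambda>n. c (r n) A B) \<longlonglongrightarrow> P A B" if "A \<subseteq> \<Omega>" "B \<subseteq> \<Omega>" for A B
    unfolding P_def using conv[OF that] by (simp add: convergent_LIMSEQ_iff)
  have limI: "P A B = l" if "A \<subseteq> \<Omega>" "B \<subseteq> \<Omega>" "(\<lambda>n. c (r n) A B) \<longlonglongrightarrow> l" for A B l
    using LIMSEQ_unique[OF P_lim that(3)] that by auto
  have "full_cond_prob \<Omega> P"
    unfolding full_cond_prob_def
  proof (intro conjI allI impI)
    fix A B assume B: "B \<subseteq> \<Omega> \<and> B \<noteq> {}"
    have *: "c n B B = 1" "c n \<Omega> B = 1" for n
      unfolding c_def using sum_p[of B n] B by (auto simp: Int_absorb1)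
    show "P \<Omega> B = 1" "P B B = 1" by (rule limI; use B * in simp)+
    fix A assume "A \<subseteq> \<Omega>"
    then show "0 \<le> P A B"
      using LIMSEQ_le_const[OF P_lim[of A B], of 0] B c_nn by auto
  next
    fix A B C assume B: "B \<subseteq> \<Omega> \<and> B \<noteq> {}" and AC: "A \<subseteq> \<Omega> \<and> C \<subseteq> \<Omega> \<and> A \<inter> C = {}"
    have "c n (A \<union> C) B = c n A B + c n C B" for n
    proof -
      have "sum (w n) (A \<inter> B \<union> C \<inter> B) = sum (w n) (A \<inter> B) + sum (w n) (C \<inter> B)"
        by (rule sum.union_disjoint) (use B AC finB in auto)
      then show ?thesis unfolding c_def by (simp add: Int_Un_distrib2 add_divide_distrib)
    qed
    then show "P (A \<union> C) B = P A B + P C B"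
      using B AC by (intro limI) (auto intro!: tendsto_add P_lim)
  next
    fix A B C assume *: "A \<subseteq> \<Omega> \<and> B \<subseteq> \<Omega> \<and> C \<subseteq> \<Omega> \<and> C \<inter> B \<noteq> {}"
    have "c n (A \<inter> C) B = c n A (C \<inter> B) * c n C B" for n
    proof -
      have "0 < sum (w n) (C \<inter> B)" by (rule sum_p) (use * in auto)
      then show ?thesis unfolding c_def by (simp add: Int_assoc)
    qed
    moreover have "A \<inter> C \<subseteq> \<Omega>" "C \<inter> B \<subseteq> \<Omega>" using * by auto
    ultimately show "P (A \<inter> C) B = P A (C \<inter> B) * P C B"
      using * by (intro limI) (auto intro!: tendsto_mult P_lim)
  qed
  moreover have "positive_approx \<Omega> P (\<lambda>n. w (r n))"
    unfolding positive_approx_def using pos P_lim by (simp add: c_def)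
  ultimately show ?thesis using r by blast
qed

lemma convex_fun_set_sum:
  assumes C: "convex_fun_set C" and "finite I" and "I \<noteq> {}"
    and "\<And>i. i \<in> I \<Longrightarrow> 0 \<le> c i" and "sum c I = 1" and "\<And>i. i \<in> I \<Longrightarrow> q i \<in> C"
  shows "(\<lambda>v. \<Sum>i\<in>I. c i * q i v) \<in> C"
  using assms(2-)
proof (induction I arbitrary: c rule: finite_ne_induct)
  case (singleton i)
  then show ?case by simp
next
  case (insert i I)
  let ?r = "sum c I"
  have ci: "c i = 1 - ?r" and r0: "0 \<le> ?r" and ci0: "0 \<le> c i"
    using insert by (auto intro: sum_nonneg)
  show ?case
  proof (cases "?r = 0")
    case True
    then have "\<forall>j\<in>I. c j = 0" using insert by (subst (asm) sum_nonneg_eq_0_iff) auto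
    then have "(\<lambda>v. \<Sum>j\<in>insert i I. c j * q j v) = q i"
      using insert.hyps ci True by (auto simp: fun_eq_iff)
    then show ?thesis using insert.prems(3) by simp
  next
    case False
    define p where "p = (\<lambda>v. \<Sum>j\<in>I. (c j / ?r) * q j v)"
    have "p \<in> C" unfolding p_def
      by (rule insert.IH) (use insert.prems r0 False in \<open>auto simp flip: sum_divide_distrib\<close>)
    moreover have "q i \<in> C" using insert.prems(3) by simp
    ultimately have "(\<lambda>v. ?r * p v + (1 - ?r) * q i v) \<in> C"
      using C r0 ci ci0 unfolding convex_fun_set_def by auto
    moreover have "(\<lambda>v. ?r * p v + (1 - ?r) * q i v) = (\<lambda>v. \<Sum>j\<in>insert i I. c j * q j v)"
    proof
      fix v
      have "?r * p v = (\<Sum>j\<in>I. c j * q j v)"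
        unfolding p_def sum_distrib_left using False by (intro sum.cong) auto
      then show "?r * p v + (1 - ?r) * q i v = (\<Sum>j\<in>insert i I. c j * q j v)"
        using insert.hyps ci by simp
    qed
    ultimately show ?thesis by simp
  qed
qed

section \<open>Ancestral and closed node sets\<close>

text \<open>These are the node sets on which a product along the DAG has an explicit marginal, since
  the remaining nodes can be summed out from below.\<close>

definition ancestral :: "('n \<Rightarrow> 'n set) \<Rightarrow> 'n set \<Rightarrow> bool" where
  "ancestral par T \<longleftrightarrow> (\<forall>t\<in>T. par t \<subseteq> T)"

lemma ancestral_trancl:
  assumes "ancestral par T" "(p, t) \<in> (edges_on par G)\<^sup>+" "t \<in> T"
  shows "p \<in> T"
  using assms(2,3)
proof (induction rule: trancl_induct)
  case (base t)
  then show ?case using assms(1) by (auto simp: ancestral_def edges_on_def)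
next
  case (step b c)
  then show ?case using assms(1) by (auto simp: ancestral_def edges_on_def)
qed

lemma edges_on_trancl_in:
  assumes "(s, t) \<in> (edges_on par G)\<^sup>+"
  shows "s \<in> G" "t \<in> G"
  using assms by (induction rule: trancl_induct) (auto simp: edges_on_def)

lemma ancestral_closed_nodes: "ancestral par N \<Longrightarrow> closed_nodes par G N"
  unfolding closed_nodes_def by (auto simp: rtrancl_eq_or_trancl dest: ancestral_trancl)

lemma closed_nodes_between:
  assumes "closed_nodes par G S" "s \<in> S" "t \<in> S"
    and "(s, k) \<in> (edges_on par G)\<^sup>+" "(k, t) \<in> (edges_on par G)\<^sup>+"
  shows "k \<in> S"
  using assms unfolding closed_nodes_def by (meson trancl_into_rtrancl)

text \<open>A directed path of \<open>G\<close> between two nodes of a closed set never leaves the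
  set, so descendants in the sub-network lose nothing.\<close>

lemma desc_on_closed:
  assumes S: "S \<subseteq> G" "closed_nodes par G S" and s: "s \<in> S"
  shows "desc_on par S s = desc_on par G s \<inter> S"
proof
  have sub: "edges_on par S \<subseteq> edges_on par G" using S by (auto simp: edges_on_def)
  show "desc_on par S s \<subseteq> desc_on par G s \<inter> S"
    using trancl_mono[OF _ sub] edges_on_trancl_in(2)[of s _ par S]
    unfolding desc_on_def by blast
  have "(s, v) \<in> (edges_on par S)\<^sup>+" if "(s, v) \<in> (edges_on par G)\<^sup>+" "v \<in> S" for v
    using that
  proof (induction rule: trancl_induct)
    case (base v)
    then show ?case using s by (auto simp: edges_on_def)
  next
    case (step b c)
    have "b \<in> S"
      by (rule closed_nodes_between[OF S(2) s step.prems step.hyps(1)]) (use step.hyps(2) in blast)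
    then have "(s, b) \<in> (edges_on par S)\<^sup>+" "(b, c) \<in> edges_on par S"
      using step by (auto simp: edges_on_def)
    then show ?case by (rule trancl_into_trancl)
  qed
  then show "desc_on par G s \<inter> S \<subseteq> desc_on par S s"
    unfolding desc_on_def by blast
qed

lemma nondesc_on_closed:
  assumes "S \<subseteq> G" "closed_nodes par G S" "s \<in> S"
  shows "nondesc_on par S s = nondesc_on par G s \<inter> S"
  using desc_on_closed[OF assms] assms(1) unfolding nondesc_on_def by auto

lemma nondesc_set_ancestral:
  assumes par: "\<forall>s\<in>G. par s \<subseteq> G" and K: "K \<subseteq> G"
  shows "ancestral par (nondesc_set par G K)"
  unfolding ancestral_def
proof (intro ballI subsetI)
  fix t p assume t: "t \<in> nondesc_set par G K" and p: "p \<in> par t"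
  have tG: "t \<in> G" "t \<notin> K" using t by (auto simp: nondesc_set_def)
  have nd: "(k, t) \<notin> (edges_on par G)\<^sup>+" if "k \<in> K" for k
    using t that by (auto simp: nondesc_set_def desc_set_def desc_on_def)
  have pG: "p \<in> G" using par p tG by auto
  have e: "(p, t) \<in> edges_on par G" using tG p pG by (auto simp: edges_on_def)
  have "p \<notin> K" using nd e by blast
  moreover have "(k, p) \<notin> (edges_on par G)\<^sup>+" if "k \<in> K" for k
    using nd[OF that] e trancl_into_trancl by metis
  ultimately show "p \<in> nondesc_set par G K"
    using pG by (auto simp: nondesc_set_def desc_set_def desc_on_def)
qed

text \<open>A parent of \<open>K\<close> that also descended from \<open>K\<close> would lie on a
  path between two nodes of \<open>K\<close>, hence in \<open>K\<close> by closedness.\<close>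

lemma closed_parents_subset_nondesc:
  assumes par: "\<forall>s\<in>G. par s \<subseteq> G" and K: "K \<subseteq> G" "closed_nodes par G K"
  shows "parents_set par K \<subseteq> nondesc_set par G K"
proof
  fix p assume "p \<in> parents_set par K"
  then obtain k where k: "k \<in> K" "p \<in> par k" "p \<notin> K" by (auto simp: parents_set_def)
  have pG: "p \<in> G" "k \<in> G" using k K par by auto
  then have "(p, k) \<in> (edges_on par G)\<^sup>+" using k(2) by (auto simp: edges_on_def)
  then have "(k', p) \<notin> (edges_on par G)\<^sup>+" if "k' \<in> K" for k'
    using closed_nodes_between[OF K(2) that k(1)] k(3) by blast
  then show "p \<in> nondesc_set par G K"
    using k pG by (auto simp: nondesc_set_def desc_set_def desc_on_def)
qed

section \<open>Cylinder sets and marginals\<close>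

text \<open>Only the values of \<open>z\<close> on \<open>T\<close> matter, and \<open>z\<close>
  need not be extensional. Hence updated assignments \<open>z(s := v)\<close> and assignments on
  larger node sets can be used without restricting them.\<close>

definition cyl :: "('n \<Rightarrow> 'v set) \<Rightarrow> 'n set \<Rightarrow> 'n set \<Rightarrow> ('n \<Rightarrow> 'v) \<Rightarrow> ('n \<Rightarrow> 'v) set" where
  "cyl X S T z = {w \<in> PiE S X. \<forall>t\<in>T. w t = z t}"

definition marginal ::
  "('n \<Rightarrow> 'v set) \<Rightarrow> 'n set \<Rightarrow> (('n \<Rightarrow> 'v) \<Rightarrow> real) \<Rightarrow> 'n set \<Rightarrow> ('n \<Rightarrow> 'v) \<Rightarrow> real" where
  "marginal X S q T z = sum q (cyl X S T z)"

lemma cyl_subset: "cyl X S T z \<subseteq> PiE S X"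
  by (auto simp: cyl_def)

lemma finite_cyl:
  "\<lbrakk>finite S; \<And>t. t \<in> S \<Longrightarrow> finite (X t)\<rbrakk> \<Longrightarrow> finite (cyl X S T z)"
  by (rule finite_subset[OF cyl_subset finite_PiE])

lemma cyl_cong: "(\<And>t. t \<in> T \<Longrightarrow> z t = z' t) \<Longrightarrow> cyl X S T z = cyl X S T z'"
  by (auto simp: cyl_def)

lemma marginal_cong: "(\<And>t. t \<in> T \<Longrightarrow> z t = z' t) \<Longrightarrow> marginal X S q T z = marginal X S q T z'"
  unfolding marginal_def by (simp cong: cyl_cong)

lemma cyl_empty: "cyl X S {} z = PiE S X"
  by (simp add: cyl_def)

lemma restrict_in_PiE: "\<lbrakk>\<And>t. t \<in> S \<Longrightarrow> z t \<in> X t\<rbrakk> \<Longrightarrow> restrict z S \<in> PiE S X"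
  by auto

lemma restrict_in_cyl:
  "\<lbrakk>\<And>t. t \<in> S \<Longrightarrow> z t \<in> X t; T \<subseteq> S\<rbrakk> \<Longrightarrow> restrict z S \<in> cyl X S T z"
  by (auto simp: cyl_def)

lemma cyl_full:
  assumes "\<And>t. t \<in> S \<Longrightarrow> z t \<in> X t"
  shows "cyl X S S z = {restrict z S}"
proof -
  have "w = restrict z S" if "w \<in> PiE S X" "\<forall>t\<in>S. w t = z t" for w
    using that by (intro PiE_ext[OF that(1) restrict_in_PiE[OF assms]]) auto
  moreover have "restrict z S \<in> cyl X S S z"
    by (rule restrict_in_cyl) (use assms in auto)
  ultimately show ?thesis unfolding cyl_def by blast
qed

lemma cyl_insert_upd:
  "s \<notin> T \<Longrightarrow> cyl X S (insert s T) (z(s := v)) = {w \<in> PiE S X. w s = v} \<inter> cyl X S T z"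
  by (auto simp: cyl_def)

lemma marginal_insert_sum:
  assumes "finite S" "\<And>t. t \<in> S \<Longrightarrow> finite (X t)" "s \<in> S" "s \<notin> T"
  shows "(\<Sum>v\<in>X s. marginal X S q (insert s T) (z(s := v))) = marginal X S q T z"
proof -
  have fin: "finite (cyl X S T z)" using assms by (intro finite_cyl)
  have "marginal X S q T z = (\<Sum>v\<in>X s. \<Sum>w\<in>{w \<in> cyl X S T z. w s = v}. q w)"
    unfolding marginal_def
    by (rule sum.group[symmetric]) (use fin assms in \<open>auto simp: cyl_def PiE_mem\<close>)
  also have "\<dots> = (\<Sum>v\<in>X s. marginal X S q (insert s T) (z(s := v)))"
    unfolding marginal_def cyl_insert_upd[OF assms(4)]
    by (intro sum.cong) (auto simp: cyl_def)
  finally show ?thesis by simp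
qed

lemma marginal_pos:
  assumes "finite S" "\<And>t. t \<in> S \<Longrightarrow> finite (X t)" "\<And>t. t \<in> S \<Longrightarrow> z t \<in> X t" "T \<subseteq> S"
    and "\<And>w. w \<in> PiE S X \<Longrightarrow> 0 < q w"
  shows "0 < marginal X S q T z"
  unfolding marginal_def
proof (rule sum_pos)
  show "finite (cyl X S T z)" using assms(1,2) by (rule finite_cyl)
  show "cyl X S T z \<noteq> {}" using restrict_in_cyl[of S z X T] assms(3,4) by auto
qed (use assms(5) in \<open>auto simp: cyl_def\<close>)

section \<open>Irrelevant natural extensions of credal networks\<close>

locale credal_network =
  fixes par :: "'n \<Rightarrow> 'n set" and X :: "'n \<Rightarrow> 'v set"
    and M :: "'n \<Rightarrow> ('n \<Rightarrow> 'v) \<Rightarrow> ('v \<Rightarrow> real) set" and G :: "'n set"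
  assumes finG: "finite G"
    and X_fin: "s \<in> G \<Longrightarrow> finite (X s)" and X_ne: "s \<in> G \<Longrightarrow> X s \<noteq> {}"
    and par_G: "s \<in> G \<Longrightarrow> par s \<subseteq> G"
    and dag: "acyclic (edges_on par G)"
    and M_ne: "\<lbrakk>s \<in> G; u \<in> PiE (par s) X\<rbrakk> \<Longrightarrow> M s u \<noteq> {}"
    and M_convex: "\<lbrakk>s \<in> G; u \<in> PiE (par s) X\<rbrakk> \<Longrightarrow> convex_fun_set (M s u)"
    and M_pmf: "\<lbrakk>s \<in> G; u \<in> PiE (par s) X; p \<in> M s u\<rbrakk> \<Longrightarrow> pmf_on (X s) p"
begin

lemma fin_PiE: "S \<subseteq> G \<Longrightarrow> finite (PiE S X)"
  using finG X_fin by (meson finite_PiE finite_subset subsetD)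

lemma PiE_ne: "S \<subseteq> G \<Longrightarrow> PiE S X \<noteq> {}"
  using X_ne by (auto simp: PiE_eq_empty_iff)

lemma not_own_descendant: "s \<notin> desc_on par G s"
  using dag unfolding desc_on_def acyclic_def by simp

lemma nondesc_ancestral: "ancestral par (nondesc_on par G s)"
  unfolding ancestral_def
proof (intro ballI subsetI)
  fix t p assume t: "t \<in> nondesc_on par G s" and p: "p \<in> par t"
  have tG: "t \<in> G" and nd: "(s, t) \<notin> (edges_on par G)\<^sup>+"
    using t by (auto simp: nondesc_on_def desc_on_def)
  have pG: "p \<in> G" using par_G[OF tG] p by auto
  have e: "(p, t) \<in> edges_on par G" using tG p pG by (auto simp: edges_on_def)
  have "p \<noteq> s" using nd e by blast
  moreover have "(s, p) \<notin> (edges_on par G)\<^sup>+" using nd e trancl_into_trancl by metis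
  ultimately show "p \<in> nondesc_on par G s"
    using pG by (auto simp: nondesc_on_def desc_on_def)
qed

lemma par_nondesc: assumes "s \<in> G" shows "par s \<subseteq> nondesc_on par G s"
proof
  fix p assume p: "p \<in> par s"
  have pG: "p \<in> G" using par_G[OF assms] p by auto
  have e: "(p, s) \<in> edges_on par G" using assms p pG by (auto simp: edges_on_def)
  have "(s, p) \<notin> (edges_on par G)\<^sup>+"
    using dag e trancl_into_trancl unfolding acyclic_def by metis
  moreover have "p \<noteq> s" using dag e unfolding acyclic_def by blast
  ultimately show "p \<in> nondesc_on par G s"
    using pG by (auto simp: nondesc_on_def desc_on_def)
qed

text \<open>Conditioning on a set \<open>T\<close> between the parents and all nondescendants of
  \<open>s\<close> mixes conditionals given all nondescendants. As \<open>T\<close> fixes the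
  parents in \<open>S\<close>, and \<open>y\<close> those outside, all of these lie in one local
  credal set, which is convex.\<close>

lemma irr_ext_coarser:
  assumes S: "S \<subseteq> G" and P: "P \<in> irr_ext par X M S y"
    and y: "\<And>s t. \<lbrakk>s \<in> S; t \<in> par s - S\<rbrakk> \<Longrightarrow> y t \<in> X t"
    and s: "s \<in> S" and T: "T \<subseteq> nondesc_on par S s" "par s \<inter> S \<subseteq> T" and z: "z \<in> PiE S X"
  shows "(\<lambda>v. P {w \<in> PiE S X. w s = v} (cyl X S T z))
     \<in> M s (restrict (\<lambda>t. if t \<in> S then z t else y t) (par s))"
proof -
  let ?N = "nondesc_on par S s"
  let ?u = "restrict (\<lambda>t. if t \<in> S then z t else y t) (par s)"
  define B where "B = cyl X S T z"
  have fc: "full_cond_prob (PiE S X) P" using P by (simp add: irr_ext_def)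
  have B: "B \<subseteq> PiE S X" "B \<noteq> {}" "finite B"
    using cyl_subset[of X S T z] z fin_PiE[OF S] unfolding B_def
    by (auto simp: cyl_def)
  have sG: "s \<in> G" using s S by auto
  have u: "?u \<in> PiE (par s) X"
  proof (rule restrict_in_PiE)
    fix t assume "t \<in> par s"
    then show "(if t \<in> S then z t else y t) \<in> X t"
      using PiE_mem[OF z] y[OF s] by auto
  qed
  define c where "c i = {w\<in>B. restrict w ?N = i}" for i
  have *: "(\<lambda>v. P {w \<in> PiE S X. w s = v} B) =
      (\<lambda>v. \<Sum>i\<in>(\<lambda>w. restrict w ?N) ` B. P (c i) B * P {w \<in> PiE S X. w s = v} (c i))"
    unfolding c_def by (rule ext, rule fcp_mixture[OF fc fin_PiE[OF S] _ B(1,2)]) auto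
  have "(\<lambda>v. \<Sum>i\<in>(\<lambda>w. restrict w ?N) ` B. P (c i) B * P {w \<in> PiE S X. w s = v} (c i)) \<in> M s ?u"
  proof (rule convex_fun_set_sum[OF M_convex[OF sG u]])
    show "finite ((\<lambda>w. restrict w ?N) ` B)" "(\<lambda>w. restrict w ?N) ` B \<noteq> {}"
      using B by auto
    show "0 \<le> P (c i) B" for i
      by (rule fcp_nonneg[OF fc _ B(1,2)]) (use B in \<open>auto simp: c_def\<close>)
    \<comment> \<open>The mixture formula for \<open>A = B\<close> yields the total weight, since
      \<open>B\<close> has probability 1 given each of its cells.\<close>
    have "P B B = (\<Sum>i\<in>(\<lambda>w. restrict w ?N) ` B. P (c i) B * P B (c i))"
      unfolding c_def by (rule fcp_mixture[OF fc fin_PiE[OF S] B(1) B(1,2)])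
    also have "\<dots> = (\<Sum>i\<in>(\<lambda>w. restrict w ?N) ` B. P (c i) B)"
    proof (rule sum.cong[OF refl])
      fix i assume "i \<in> (\<lambda>w. restrict w ?N) ` B"
      then have ci: "c i \<subseteq> PiE S X" "c i \<noteq> {}" "B \<inter> c i = c i"
        using B by (auto simp: c_def)
      then have "P B (c i) = 1"
        using fcp_Int[OF fc B(1) ci(1,2)] fcp_self[OF fc ci(1,2)] by simp
      then show "P (c i) B * P B (c i) = P (c i) B" by simp
    qed
    finally show "(\<Sum>i\<in>(\<lambda>w. restrict w ?N) ` B. P (c i) B) = 1"
      using fcp_self[OF fc B(1,2)] by simp
    fix i assume "i \<in> (\<lambda>w. restrict w ?N) ` B"
    then obtain w0 where w0: "w0 \<in> B" "i = restrict w0 ?N" by auto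
    have agree: "w0 t = z t" if "t \<in> T" for t using w0(1) that by (auto simp: B_def cyl_def)
    \<comment> \<open>Each cell is exactly one of the events that occur in \<open>irr_ext\<close>,
      represented by \<open>w0\<close>, and \<open>w0\<close> has the same parent values as
      \<open>z\<close>.\<close>
    have "c i = {w \<in> PiE S X. \<forall>t\<in>?N. w t = w0 t}"
    proof -
      have "restrict w ?N = restrict w0 ?N \<longleftrightarrow> (\<forall>t\<in>?N. w t = w0 t)" for w
        by (auto simp: fun_eq_iff restrict_def)
      then show ?thesis
        unfolding c_def w0(2) B_def cyl_def using T(1) agree by fastforce
    qed
    moreover have "restrict (\<lambda>t. if t \<in> S then w0 t else y t) (par s) = ?u"
      using T(2) agree by (auto simp: fun_eq_iff restrict_def)
    moreover have "w0 \<in> PiE S X" using w0(1) B(1) by auto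
    ultimately show "(\<lambda>v. P {w \<in> PiE S X. w s = v} (c i)) \<in> M s ?u"
      using P s unfolding irr_ext_def by fastforce
  qed
  then show ?thesis using * unfolding B_def by simp
qed

abbreviation expect :: "(('n \<Rightarrow> 'v) set \<Rightarrow> ('n \<Rightarrow> 'v) set \<Rightarrow> real) \<Rightarrow> 'n set \<Rightarrow> (('n \<Rightarrow> 'v) \<Rightarrow> real) \<Rightarrow> real" where
  "expect P S f \<equiv> \<Sum>z\<in>PiE S X. f z * P {z} (PiE S X)"

lemma lower_exp_le:
  assumes S: "S \<subseteq> G" and P: "P \<in> irr_ext par X M S y"
  shows "lower_exp_irr par X M S y f \<le> expect P S f"
  unfolding lower_exp_irr_def
proof (rule cInf_lower)
  show "expect P S f \<in> {expect P S f |P. P \<in> irr_ext par X M S y}" using P by blast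
  \<comment> \<open>An explicit bound, uniform in the measure: an infimum of reals is a lower bound
    only for a set that is bounded below.\<close>
  have "- (\<Sum>z\<in>PiE S X. \<bar>f z\<bar>) \<le> expect Q S f" if Q: "Q \<in> irr_ext par X M S y" for Q
  proof -
    have fc: "full_cond_prob (PiE S X) Q" using Q by (simp add: irr_ext_def)
    have "- \<bar>f z\<bar> \<le> f z * Q {z} (PiE S X)" if z: "z \<in> PiE S X" for z
    proof -
      have "0 \<le> Q {z} (PiE S X)" "Q {z} (PiE S X) \<le> 1"
        using fcp_nonneg[OF fc _ order_refl PiE_ne[OF S], of "{z}"]
          fcp_le_1[OF fc _ order_refl PiE_ne[OF S], of "{z}"] z by simp_all
      then have "\<bar>f z * Q {z} (PiE S X)\<bar> \<le> \<bar>f z\<bar>"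
        by (simp add: abs_mult mult_left_le)
      then show ?thesis by linarith
    qed
    then have "(\<Sum>z\<in>PiE S X. - \<bar>f z\<bar>) \<le> expect Q S f" by (rule sum_mono)
    then show ?thesis by (simp add: sum_negf)
  qed
  then show "bdd_below {expect P S f |P. P \<in> irr_ext par X M S y}"
    by (intro bdd_belowI[of _ "- (\<Sum>z\<in>PiE S X. \<bar>f z\<bar>)"]) blast
qed

lemma lower_exp_greatest:
  assumes "irr_ext par X M S y \<noteq> {}" "\<And>P. P \<in> irr_ext par X M S y \<Longrightarrow> c \<le> expect P S f"
  shows "c \<le> lower_exp_irr par X M S y f"
  unfolding lower_exp_irr_def using assms by (intro cInf_greatest) blast+

section \<open>Conditionals of an extension on sub-networks, and the lower bound\<close>

text \<open>Condition on \<open>X_U = y\<close> and project to \<open>S\<close>. Since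
  \<open>U\<close> contains no descendant of \<open>S\<close>, fixing \<open>U\<close> together with
  the nondescendants of \<open>s\<close> inside \<open>S\<close> fixes only nondescendants of
  \<open>s\<close> in \<open>G\<close>, all its parents among them, so
  \<open>irr_ext_coarser\<close> applies. With \<open>U\<close> empty this gives marginals on
  \<open>N\<close>; with \<open>S = K\<close> and \<open>U = N\<close> it gives the conditionals on
  \<open>K\<close>.\<close>

lemma conditional_irr_ext:
  assumes P: "P \<in> irr_ext par X M G y0"
    and S: "S \<subseteq> G" "closed_nodes par G S" and U: "U \<subseteq> G" "U \<inter> S = {}"
    and par_S: "\<And>s. s \<in> S \<Longrightarrow> par s \<subseteq> S \<union> U"
    and desc_S: "\<And>s. s \<in> S \<Longrightarrow> U \<inter> desc_on par G s = {}"
    and y: "y \<in> PiE G X" and y': "\<And>t. t \<in> parents_set par S \<Longrightarrow> y' t = y t"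
  shows "(\<lambda>A B. P {w \<in> cyl X G U y. restrict w S \<in> A} {w \<in> cyl X G U y. restrict w S \<in> B})
      \<in> irr_ext par X M S y'"
proof -
  define J where "J A = {w \<in> cyl X G U y. restrict w S \<in> A}" for A
  have fc: "full_cond_prob (PiE G X) P" using P by (simp add: irr_ext_def)
  \<comment> \<open>Completing \<open>z\<close> by \<open>y\<close> gives a point of the cylinder
    above \<open>z\<close>: it shows that preimages of nonempty events are nonempty, and it
    represents the conditioning event in \<open>G\<close>.\<close>
  define glue where "glue z = (\<lambda>t. if t \<in> S then z t else y t)" for z
  have glue: "glue z \<in> PiE G X" "glue z \<in> cyl X G U y" "restrict (glue z) S = z" if "z \<in> PiE S X" for z
  proof -
    show g: "glue z \<in> PiE G X"
    proof (rule PiE_I)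
      show "glue z t \<in> X t" if "t \<in> G" for t
        using that PiE_mem[OF \<open>z \<in> PiE S X\<close>] PiE_mem[OF y] by (auto simp: glue_def)
      show "glue z t = undefined" if "t \<notin> G" for t
        using that S(1) PiE_arb[OF y] by (auto simp: glue_def)
    qed
    show "glue z \<in> cyl X G U y" using g U(2) by (auto simp: cyl_def glue_def)
    show "restrict (glue z) S = z"
      using PiE_arb[OF that] by (auto simp: glue_def fun_eq_iff restrict_def)
  qed
  have J_sub: "J A \<subseteq> PiE G X" for A using cyl_subset[of X G U y] by (auto simp: J_def)
  have J_ne: "J B \<noteq> {}" if "B \<subseteq> PiE S X" "B \<noteq> {}" for B
  proof -
    obtain z where "z \<in> B" using \<open>B \<noteq> {}\<close> by auto
    then have "glue z \<in> J B" using glue[of z] that(1) by (auto simp: J_def)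
    then show ?thesis by auto
  qed
  have "full_cond_prob (PiE S X) (\<lambda>A B. P (J A) (J B))"
    by (rule fcp_pullback[OF fc J_sub J_ne]) (auto simp: J_def)
  moreover have "(\<lambda>v. P (J {w \<in> PiE S X. w s = v}) (J {w \<in> PiE S X. \<forall>t\<in>nondesc_on par S s. w t = z t}))
      \<in> M s (restrict (\<lambda>t. if t \<in> S then z t else y' t) (par s))"
    if s: "s \<in> S" and z: "z \<in> PiE S X" for s z
  proof -
    let ?T = "nondesc_on par S s \<union> U"
    have sG: "s \<in> G" using s S by auto
    have nd: "nondesc_on par S s = nondesc_on par G s \<inter> S"
      by (rule nondesc_on_closed[OF S s])
    have "U \<subseteq> nondesc_on par G s"
      using U desc_S[OF s] s by (auto simp: nondesc_on_def)
    then have T: "?T \<subseteq> nondesc_on par G s" "par s \<inter> G \<subseteq> ?T"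
      using nd par_S[OF s] par_nondesc[OF sG] by auto
    have "(\<lambda>v. P {w \<in> PiE G X. w s = v} (cyl X G ?T (glue z)))
       \<in> M s (restrict (\<lambda>t. if t \<in> G then glue z t else y0 t) (par s))"
      by (rule irr_ext_coarser[OF order_refl P _ sG T glue(1)[OF z]]) (use par_G in auto)
    moreover have "restrict (\<lambda>t. if t \<in> G then glue z t else y0 t) (par s)
        = restrict (\<lambda>t. if t \<in> S then z t else y' t) (par s)"
    proof (rule restrict_ext)
      fix t assume t: "t \<in> par s"
      then have "t \<in> G" using par_G[OF sG] by auto
      moreover have "y' t = y t" if "t \<notin> S"
        by (rule y') (use t that s in \<open>auto simp: parents_set_def\<close>)
      ultimately show "(if t \<in> G then glue z t else y0 t) = (if t \<in> S then z t else y' t)"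
        by (simp add: glue_def)
    qed
    moreover have JT: "J {w \<in> PiE S X. \<forall>t\<in>nondesc_on par S s. w t = z t} = cyl X G ?T (glue z)"
    proof -
      have "restrict w S \<in> PiE S X" if "w \<in> PiE G X" for w
        by (rule restrict_in_PiE) (use PiE_mem[OF that] S in auto)
      then show ?thesis
        using nd U(2) by (fastforce simp: J_def cyl_def glue_def)
    qed
    moreover have "P (J {w \<in> PiE S X. w s = v}) (cyl X G ?T (glue z))
        = P {w \<in> PiE G X. w s = v} (cyl X G ?T (glue z))" for v
    proof (rule fcp_cong[OF fc J_sub])
      show "cyl X G ?T (glue z) \<subseteq> PiE G X" by (rule cyl_subset)
      show "cyl X G ?T (glue z) \<noteq> {}" using glue(1)[OF z] by (auto simp: cyl_def)
      have "restrict w S \<in> PiE S X" if "w \<in> PiE G X" for w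
        by (rule restrict_in_PiE) (use PiE_mem[OF that] S in auto)
      then show "J {w \<in> PiE S X. w s = v} \<inter> cyl X G ?T (glue z)
          = {w \<in> PiE G X. w s = v} \<inter> cyl X G ?T (glue z)"
        using s U(2) by (auto simp: J_def cyl_def glue_def)
    qed auto
    ultimately show ?thesis by simp
  qed
  ultimately show ?thesis unfolding irr_ext_def J_def by simp
qed

text \<open>The space is split along the value \<open>u\<close> of \<open>X_N\<close>. Here
  \<open>g\<close> is a function on \<open>N\<close> that has absorbed the indicator: it vanishes
  unless \<open>u\<close> agrees with \<open>x\<close> on the parents of \<open>K\<close>. The
  values \<open>y0\<close> and \<open>y1\<close> are arbitrary, as neither \<open>G\<close> nor
  \<open>N\<close> has parents outside itself.\<close>

lemma expect_ge_lower_exp: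
  assumes P: "P \<in> irr_ext par X M G y0"
    and N: "N \<subseteq> G" "ancestral par N" and K: "K \<subseteq> G" "closed_nodes par G K" "N \<inter> K = {}"
    and par_K: "\<And>s. s \<in> K \<Longrightarrow> par s \<subseteq> K \<union> N"
    and g: "\<And>u. u \<in> PiE N X \<Longrightarrow> 0 \<le> g u"
      "\<And>u t. \<lbrakk>u \<in> PiE N X; g u \<noteq> 0; t \<in> parents_set par K\<rbrakk> \<Longrightarrow> x t = u t"
  shows "lower_exp_irr par X M N y1 (\<lambda>u. h u + g u * lower_exp_irr par X M K x f)
    \<le> expect P G (\<lambda>z. h (restrict z N) + g (restrict z N) * f (restrict z K))"
proof -
  let ?\<Omega> = "PiE G X"
  let ?F = "\<lambda>z. h (restrict z N) + g (restrict z N) * f (restrict z K)"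
  let ?L = "lower_exp_irr par X M K x f"
  have fc: "full_cond_prob ?\<Omega> P" using P by (simp add: irr_ext_def)
  have fin: "finite ?\<Omega>" by (rule fin_PiE) simp
  have ne: "?\<Omega> \<noteq> {}" by (rule PiE_ne) simp
  have res: "restrict w S \<in> PiE S X" if "w \<in> ?\<Omega>" "S \<subseteq> G" for w S
    by (rule restrict_in_PiE) (use PiE_mem[OF that(1)] that(2) in auto)
  define C where "C u = {z \<in> ?\<Omega>. restrict z N = u}" for u
  have C_sub: "C u \<subseteq> ?\<Omega>" for u by (auto simp: C_def)
  obtain y where y: "y \<in> ?\<Omega>" using ne by auto
  define P1 where "P1 A B = P {w \<in> cyl X G {} y. restrict w N \<in> A} {w \<in> cyl X G {} y. restrict w N \<in> B}" for A B
  have "(\<lambda>A B. P1 A B) \<in> irr_ext par X M N y1"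
    unfolding P1_def
    by (rule conditional_irr_ext[OF P N(1) ancestral_closed_nodes[OF N(2)] _ _ _ _ y])
       (use N(2) in \<open>auto simp: ancestral_def parents_set_def\<close>)
  then have P1: "P1 \<in> irr_ext par X M N y1" by simp
  have "{w \<in> ?\<Omega>. restrict w N \<in> PiE N X} = ?\<Omega>" using res N(1) by blast
  then have P1_eq: "P1 {u} (PiE N X) = P (C u) ?\<Omega>" for u
    by (simp add: P1_def C_def cyl_empty)
  have inner: "(h u + g u * ?L) * P (C u) ?\<Omega> \<le> (\<Sum>z\<in>C u. ?F z * P {z} ?\<Omega>)" if u: "u \<in> PiE N X" for u
  proof -
    define yu where "yu = (\<lambda>t. if t \<in> N then u t else y t)"
    have yu: "yu \<in> ?\<Omega>"
    proof (rule PiE_I)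
      show "yu t \<in> X t" if "t \<in> G" for t
        using that PiE_mem[OF u] PiE_mem[OF y] by (auto simp: yu_def)
      show "yu t = undefined" if "t \<notin> G" for t
        using that N(1) PiE_arb[OF y] by (auto simp: yu_def)
    qed
    have "restrict yu N = u"
      using PiE_arb[OF u] by (auto simp: yu_def fun_eq_iff restrict_def)
    then have Cu: "C u \<noteq> {}" using yu by (auto simp: C_def)
    have C_cyl: "C u = cyl X G N yu"
    proof -
      have "restrict z N = u \<longleftrightarrow> (\<forall>t\<in>N. z t = u t)" for z
        using PiE_arb[OF u] by (auto simp: fun_eq_iff restrict_def)
      then show ?thesis by (auto simp: C_def cyl_def yu_def)
    qed
    define q where "q z = P {z} (C u)" for z
    have q_sum: "P A (C u) = sum q A" if "A \<subseteq> ?\<Omega>" for A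
      unfolding q_def by (rule fcp_sum[OF fc fin that C_sub Cu])
    \<comment> \<open>Where \<open>g u\<close> is nonzero, \<open>u\<close> takes the value
      \<open>x\<close> on the parents of \<open>K\<close>, so the conditional given
      \<open>X_N = u\<close> projects to a member of the extension for \<open>x\<close>. This holds
      even if \<open>C u\<close> is null.\<close>
    have key: "g u * ?L \<le> g u * (\<Sum>z\<in>C u. f (restrict z K) * q z)"
    proof (cases "g u = 0")
      case False
      define P2 where "P2 A B = P {w \<in> cyl X G N yu. restrict w K \<in> A} {w \<in> cyl X G N yu. restrict w K \<in> B}" for A B
      have "(\<lambda>A B. P2 A B) \<in> irr_ext par X M K x"
        unfolding P2_def
      proof (rule conditional_irr_ext[OF P K(1,2) N(1) K(3) _ _ yu])
        show "par s \<subseteq> K \<union> N" if "s \<in> K" for s by (rule par_K[OF that])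
        show "N \<inter> desc_on par G s = {}" if "s \<in> K" for s
          using ancestral_trancl[OF N(2)] that K(3) unfolding desc_on_def by blast
        show "x t = yu t" if "t \<in> parents_set par K" for t
          using g(2)[OF u False that] that par_K by (auto simp: parents_set_def yu_def)
      qed
      then have "?L \<le> expect P2 K f" by (intro lower_exp_le[OF K(1)]) simp
      also have "\<dots> = (\<Sum>k\<in>PiE K X. \<Sum>z\<in>{z \<in> C u. restrict z K = k}. f (restrict z K) * q z)"
      proof (rule sum.cong[OF refl])
        fix k assume k: "k \<in> PiE K X"
        have "{w \<in> C u. restrict w K \<in> PiE K X} = C u" using res[OF _ K(1)] C_sub by blast
        then have "P2 {k} (PiE K X) = P {z \<in> C u. restrict z K = k} (C u)"
          unfolding P2_def C_cyl[symmetric] by simp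
        also have "\<dots> = sum q {z \<in> C u. restrict z K = k}"
          by (rule q_sum) (use C_sub in auto)
        finally show "f k * P2 {k} (PiE K X) = (\<Sum>z\<in>{z \<in> C u. restrict z K = k}. f (restrict z K) * q z)"
          by (simp add: sum_distrib_left)
      qed
      also have "\<dots> = (\<Sum>z\<in>C u. f (restrict z K) * q z)"
      proof (rule sum.group[OF finite_subset[OF C_sub fin] fin_PiE[OF K(1)]])
        show "(\<lambda>z. restrict z K) ` C u \<subseteq> PiE K X" using res[OF _ K(1)] C_sub by blast
      qed
      finally show ?thesis by (rule mult_left_mono[OF _ g(1)[OF u]])
    qed simp
    have hu: "(\<Sum>z\<in>C u. h u * q z) = h u"
      using q_sum[OF C_sub, of u] fcp_self[OF fc C_sub Cu] by (simp flip: sum_distrib_left)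
    have C_nonneg: "0 \<le> P (C u) ?\<Omega>" by (rule fcp_nonneg[OF fc C_sub order_refl ne])
    have "(h u + g u * ?L) * P (C u) ?\<Omega>
        \<le> (h u + g u * (\<Sum>z\<in>C u. f (restrict z K) * q z)) * P (C u) ?\<Omega>"
      by (intro mult_right_mono C_nonneg add_left_mono key)
    also have "(h u + g u * (\<Sum>z\<in>C u. f (restrict z K) * q z)) * P (C u) ?\<Omega>
        = ((\<Sum>z\<in>C u. h u * q z) + g u * (\<Sum>z\<in>C u. f (restrict z K) * q z)) * P (C u) ?\<Omega>"
      by (simp only: hu)
    also have "\<dots> = (\<Sum>z\<in>C u. (h u + g u * f (restrict z K)) * (q z * P (C u) ?\<Omega>))"
      by (simp add: sum_distrib_left sum_distrib_right sum.distrib algebra_simps flip: sum.distrib)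
    also have "\<dots> = (\<Sum>z\<in>C u. ?F z * P {z} ?\<Omega>)"
    proof (rule sum.cong[OF refl])
      fix z assume z: "z \<in> C u"
      then have "P {z} ?\<Omega> = q z * P (C u) ?\<Omega>"
        unfolding q_def by (intro fcp_chain[OF fc _ C_sub order_refl Cu]) auto
      then show "(h u + g u * f (restrict z K)) * (q z * P (C u) ?\<Omega>) = ?F z * P {z} ?\<Omega>"
        using z by (simp add: C_def)
    qed
    finally show ?thesis .
  qed
  have "lower_exp_irr par X M N y1 (\<lambda>u. h u + g u * ?L) \<le> expect P1 N (\<lambda>u. h u + g u * ?L)"
    by (rule lower_exp_le[OF N(1) P1])
  also have "\<dots> \<le> (\<Sum>u\<in>PiE N X. \<Sum>z\<in>C u. ?F z * P {z} ?\<Omega>)"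
    unfolding P1_eq by (rule sum_mono[OF inner])
  also have "\<dots> = expect P G ?F"
    unfolding C_def
  proof (rule sum.group[OF fin fin_PiE[OF N(1)]])
    show "(\<lambda>z. restrict z N) ` ?\<Omega> \<subseteq> PiE N X" using res[OF _ N(1)] by blast
  qed
  finally show ?thesis .
qed

end

section \<open>Gluing an extension on \<open>K\<close> to an extension on its nondescendants\<close>

locale gluing = credal_network par X M G
  for par :: "'n \<Rightarrow> 'n set" and X :: "'n \<Rightarrow> 'v set"
    and M :: "'n \<Rightarrow> ('n \<Rightarrow> 'v) \<Rightarrow> ('v \<Rightarrow> real) set" and G :: "'n set" +
  fixes N K :: "'n set" and x :: "'n \<Rightarrow> 'v"
  assumes N_G: "N \<subseteq> G" and N_anc: "ancestral par N"
    and K_G: "K \<subseteq> G" and K_closed: "closed_nodes par G K" and NK: "N \<inter> K = {}"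
    and par_K: "s \<in> K \<Longrightarrow> par s \<subseteq> K \<union> N"
    and x_in: "t \<in> parents_set par K \<Longrightarrow> x t \<in> X t"
begin

text \<open>The nodes of \<open>K\<close> all of whose ancestors in \<open>P(K)\<close> agree with \<open>x\<close>. On these nodes the joint
  weight below uses the given measure on \<open>K\<close>, on the rest it uses arbitrary local models. This
  keeps each node of \<open>N\<close> irrelevant to its nondescendants in \<open>K\<close> although the measure on \<open>K\<close> is
  prescribed for the parent value \<open>x\<close> only.\<close>

definition unaffected :: "('n \<Rightarrow> 'v) \<Rightarrow> 'n set" where
  "unaffected z = {k\<in>K. \<forall>p\<in>parents_set par K. k \<in> desc_on par G p \<longrightarrow> z p = x p}"

text \<open>Given for every node set \<open>T\<close> and not only for \<open>G\<close>, because for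
  ancestral \<open>T\<close> the same formula is the marginal on \<open>T\<close>, see
  \<open>marginal_joint\<close>. Conditionals given nondescendants thus become quotients of two
  values of \<open>joint\<close>. At the empty set it is the product of the total masses of
  \<open>q1\<close> and \<open>q2\<close>.\<close>

definition joint ::
  "(('n \<Rightarrow> 'v) \<Rightarrow> real) \<Rightarrow> (('n \<Rightarrow> 'v) \<Rightarrow> real) \<Rightarrow> ('n \<Rightarrow> ('n \<Rightarrow> 'v) \<Rightarrow> 'v \<Rightarrow> real)
    \<Rightarrow> 'n set \<Rightarrow> ('n \<Rightarrow> 'v) \<Rightarrow> real" where
  "joint q1 q2 m T z = marginal X N q1 (T \<inter> N) z * marginal X K q2 (unaffected z \<inter> T) z
     * (\<Prod>s\<in>T - N - unaffected z. m s (restrict z (par s)) (z s))"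

lemma unaffected_subset: "unaffected z \<subseteq> K"
  by (auto simp: unaffected_def)

text \<open>Whether a node is unaffected is decided by the values of its ancestors, and an ancestral
  set contains those of its members.\<close>

lemma unaffected_cong:
  assumes "ancestral par T" "\<And>t. t \<in> T \<Longrightarrow> z t = z' t"
  shows "unaffected z \<inter> T = unaffected z' \<inter> T"
proof -
  have "p \<in> T" if "k \<in> T" "k \<in> desc_on par G p" for k p
    using ancestral_trancl[OF assms(1)] that unfolding desc_on_def by blast
  then show ?thesis using assms(2) unfolding unaffected_def by auto
qed

lemma unaffected_upd:
  assumes "ancestral par T" "s \<notin> T"
  shows "s \<in> unaffected (z(s := v)) \<longleftrightarrow> s \<in> unaffected z"
    and "unaffected (z(s := v)) \<inter> T = unaffected z \<inter> T"
proof -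
  show "s \<in> unaffected (z(s := v)) \<longleftrightarrow> s \<in> unaffected z"
    using not_own_descendant unfolding unaffected_def by auto
  show "unaffected (z(s := v)) \<inter> T = unaffected z \<inter> T"
    by (rule unaffected_cong[OF assms(1)]) (use assms(2) in auto)
qed

lemma joint_cong:
  assumes T: "ancestral par T" and eq: "\<And>t. t \<in> T \<Longrightarrow> z t = z' t"
  shows "joint q1 q2 m T z = joint q1 q2 m T z'"
proof -
  have U: "unaffected z \<inter> T = unaffected z' \<inter> T" by (rule unaffected_cong[OF T eq])
  have "restrict z (par s) = restrict z' (par s)" if "s \<in> T" for s
    by (rule restrict_ext) (use T eq that in \<open>auto simp: ancestral_def\<close>)
  then have "(\<Prod>s\<in>T - N - unaffected z. m s (restrict z (par s)) (z s))
      = (\<Prod>s\<in>T - N - unaffected z'. m s (restrict z' (par s)) (z' s))"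
    using U eq by (intro prod.cong) auto
  moreover have "marginal X N q1 (T \<inter> N) z = marginal X N q1 (T \<inter> N) z'"
    by (rule marginal_cong) (use eq in auto)
  moreover have "marginal X K q2 (unaffected z' \<inter> T) z = marginal X K q2 (unaffected z' \<inter> T) z'"
    by (rule marginal_cong) (use eq in auto)
  ultimately show ?thesis unfolding joint_def U by simp
qed

section \<open>Adding one node to an ancestral set\<close>

context
  fixes T :: "'n set" and s :: 'n and z :: "'n \<Rightarrow> 'v" and v :: 'v
  assumes T: "ancestral par T" "T \<subseteq> G" and s: "s \<in> G" "s \<notin> T" "par s \<subseteq> T"
begin

private lemma prod_upd:
  "(\<Prod>t\<in>T - N - unaffected (z(s := v)). m t (restrict (z(s := v)) (par t)) ((z(s := v)) t))
    = (\<Prod>t\<in>T - N - unaffected z. m t (restrict z (par t)) (z t))"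
proof -
  have "restrict (z(s := v)) (par t) = restrict z (par t)" if "t \<in> T" for t
    by (rule restrict_ext) (use T(1) s(2) that in \<open>auto simp: ancestral_def\<close>)
  then show ?thesis
    using unaffected_upd(2)[OF T(1) s(2), of z v] s(2) by (intro prod.cong) auto
qed

private lemma marginal_upd:
  "T' \<subseteq> T \<Longrightarrow> marginal X S q T' (z(s := v)) = marginal X S q T' z"
  by (rule marginal_cong) (use s(2) in auto)

text \<open>The new node is outside \<open>K\<close>, and no node of \<open>T\<close> descends from
  it. So the unaffected nodes of \<open>T\<close> stay the same even if \<open>s\<close> is a parent
  of \<open>K\<close>, and \<open>v\<close> enters the \<open>q1\<close> factor alone; the rest will
  cancel in conditionals.\<close>

lemma joint_insert_N:
  assumes "s \<in> N"
  shows "joint q1 q2 m (insert s T) (z(s := v)) = marginal X N q1 (insert s (T \<inter> N)) (z(s := v))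
    * (marginal X K q2 (unaffected z \<inter> T) z * (\<Prod>t\<in>T - N - unaffected z. m t (restrict z (par t)) (z t)))"
proof -
  have "s \<notin> unaffected (z(s := v))" using assms NK unaffected_subset by blast
  then have "unaffected (z(s := v)) \<inter> insert s T = unaffected z \<inter> T"
    using unaffected_upd(2)[OF T(1) s(2), of z v] by auto
  moreover have "insert s T \<inter> N = insert s (T \<inter> N)" using assms by auto
  moreover have "insert s T - N - unaffected (z(s := v)) = T - N - unaffected (z(s := v))"
    using assms by auto
  ultimately show ?thesis
    unfolding joint_def by (simp only: prod_upd marginal_upd[OF Int_lower2] mult.assoc)
qed

text \<open>The status of \<open>s\<close> is decided by its proper ancestors, so \<open>v\<close>
  cannot change it and enters only the marginal of \<open>q2\<close>.\<close>

lemma joint_insert_unaffected: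
  assumes "s \<in> unaffected z"
  shows "joint q1 q2 m (insert s T) (z(s := v)) = marginal X K q2 (insert s (unaffected z \<inter> T)) (z(s := v))
    * (marginal X N q1 (T \<inter> N) z * (\<Prod>t\<in>T - N - unaffected z. m t (restrict z (par t)) (z t)))"
proof -
  have "s \<in> unaffected (z(s := v))" using assms unaffected_upd(1)[OF T(1) s(2)] by simp
  then have "unaffected (z(s := v)) \<inter> insert s T = insert s (unaffected z \<inter> T)"
    and "insert s T - N - unaffected (z(s := v)) = T - N - unaffected (z(s := v))"
    using unaffected_upd(2)[OF T(1) s(2), of z v] by auto
  moreover have "insert s T \<inter> N = T \<inter> N" using assms NK unaffected_subset by blast
  ultimately show ?thesis
    unfolding joint_def by (simp only: prod_upd marginal_upd[OF Int_lower1] mult_ac)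
qed

text \<open>Affected nodes of \<open>K\<close> and nodes outside \<open>N\<close> and
  \<open>K\<close> each contribute a single local factor.\<close>

lemma joint_insert_other:
  assumes "s \<notin> N" "s \<notin> unaffected z"
  shows "joint q1 q2 m (insert s T) (z(s := v)) = m s (restrict z (par s)) v * joint q1 q2 m T z"
proof -
  have ns: "s \<notin> unaffected (z(s := v))" using assms unaffected_upd(1)[OF T(1) s(2)] by simp
  then have "unaffected (z(s := v)) \<inter> insert s T = unaffected z \<inter> T"
    using unaffected_upd(2)[OF T(1) s(2), of z v] by auto
  moreover have "insert s T \<inter> N = T \<inter> N" using assms by auto
  moreover have "(\<Prod>t\<in>insert s T - N - unaffected (z(s := v)). m t (restrict (z(s := v)) (par t)) ((z(s := v)) t))
      = m s (restrict z (par s)) v * (\<Prod>t\<in>T - N - unaffected z. m t (restrict z (par t)) (z t))"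
  proof -
    have "insert s T - N - unaffected (z(s := v)) = insert s (T - N - unaffected (z(s := v)))"
      using assms ns by auto
    moreover have "restrict (z(s := v)) (par s) = restrict z (par s)"
      by (rule restrict_ext) (use s in auto)
    moreover have "finite (T - N - unaffected (z(s := v)))" using T(2) finG by (meson finite_Diff finite_subset)
    ultimately show ?thesis
      using s(2) by (simp add: prod_upd del: fun_upd_apply) simp
  qed
  ultimately show ?thesis
    unfolding joint_def by (simp only: marginal_upd[OF Int_lower1] marginal_upd[OF Int_lower2] mult_ac)
qed

end

section \<open>Marginals, positivity and continuity of the joint weight\<close>

lemma joint_insert_sum:
  assumes T: "ancestral par T" "T \<subseteq> G" and s: "s \<in> G" "s \<notin> T" "par s \<subseteq> T"
    and z: "\<And>t. t \<in> T \<Longrightarrow> z t \<in> X t"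
    and m: "\<And>u. u \<in> PiE (par s) X \<Longrightarrow> sum (m s u) (X s) = 1"
  shows "(\<Sum>v\<in>X s. joint q1 q2 m (insert s T) (z(s := v))) = joint q1 q2 m T z"
proof -
  have fin: "finite N" "finite K" using N_G K_G finG finite_subset by auto
  consider "s \<in> N" | "s \<in> unaffected z" | "s \<notin> N" "s \<notin> unaffected z" by blast
  then show ?thesis
  proof cases
    case 1
    have "(\<Sum>v\<in>X s. marginal X N q1 (insert s (T \<inter> N)) (z(s := v))) = marginal X N q1 (T \<inter> N) z"
      by (rule marginal_insert_sum[OF fin(1)]) (use 1 s X_fin N_G in auto)
    then show ?thesis
      unfolding joint_insert_N[OF T s 1] by (simp add: joint_def mult.assoc flip: sum_distrib_right)
  next
    case 2
    have "(\<Sum>v\<in>X s. marginal X K q2 (insert s (unaffected z \<inter> T)) (z(s := v)))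
        = marginal X K q2 (unaffected z \<inter> T) z"
      by (rule marginal_insert_sum[OF fin(2)]) (use subsetD[OF unaffected_subset 2] s X_fin K_G in auto)
    then show ?thesis
      unfolding joint_insert_unaffected[OF T s 2] sum_distrib_right[symmetric]
      by (simp add: joint_def mult_ac)
  next
    case 3
    have "sum (m s (restrict z (par s))) (X s) = 1"
      by (intro m restrict_in_PiE z) (use s in auto)
    then show ?thesis
      unfolding joint_insert_other[OF T s 3] by (simp flip: sum_distrib_right)
  qed
qed

text \<open>Reverse induction: the marginal on \<open>T\<close> is the sum, over the values of one
  further node, of marginals on a larger set. A node that is minimal among the missing ones has all
  its parents in \<open>T\<close>, so the larger set is again ancestral and that node can be summed
  out of the formula.\<close>

lemma marginal_joint:
  assumes m: "\<And>s u. \<lbrakk>s \<in> G; u \<in> PiE (par s) X\<rbrakk> \<Longrightarrow> sum (m s u) (X s) = 1"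
    and "ancestral par T" "T \<subseteq> G" "\<And>t. t \<in> T \<Longrightarrow> z t \<in> X t"
  shows "marginal X G (joint q1 q2 m G) T z = joint q1 q2 m T z"
  using assms(2-)
proof (induction "card (G - T)" arbitrary: T z rule: less_induct)
  case less
  note T = less.prems(1,2) and z = less.prems(3)
  have ancG: "ancestral par G" using par_G by (auto simp: ancestral_def)
  show ?case
  proof (cases "T = G")
    case True
    then have "marginal X G (joint q1 q2 m G) T z = joint q1 q2 m G (restrict z G)"
      using cyl_full[of G z X] z by (simp add: marginal_def)
    also have "\<dots> = joint q1 q2 m G z" by (rule joint_cong[OF ancG]) auto
    finally show ?thesis using True by simp
  next
    case False
    have "finite (edges_on par G)"
      by (rule finite_subset[of _ "G \<times> G"]) (use finG in \<open>auto simp: edges_on_def\<close>)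
    then have "wf (edges_on par G)" using finite_acyclic_wf dag by blast
    moreover have "G - T \<noteq> {}" using False T(2) by auto
    ultimately obtain s where s: "s \<in> G - T" "\<And>p. (p, s) \<in> edges_on par G \<Longrightarrow> p \<notin> G - T"
      using wfE_min' by metis
    have par_s: "par s \<subseteq> T"
    proof
      fix p assume p: "p \<in> par s"
      then have "p \<in> G" using par_G s(1) by auto
      then show "p \<in> T" using s(2)[of p] p s(1) by (auto simp: edges_on_def)
    qed
    have "marginal X G (joint q1 q2 m G) T z
        = (\<Sum>v\<in>X s. marginal X G (joint q1 q2 m G) (insert s T) (z(s := v)))"
      by (rule marginal_insert_sum[symmetric]) (use finG X_fin s(1) in auto)
    also have "\<dots> = (\<Sum>v\<in>X s. joint q1 q2 m (insert s T) (z(s := v)))"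
    proof (rule sum.cong[OF refl], rule less.hyps)
      show "card (G - insert s T) < card (G - T)"
        using s(1) finG by (intro psubset_card_mono) auto
      show "ancestral par (insert s T)" using T(1) par_s by (auto simp: ancestral_def)
    qed (use T(2) s(1) z in auto)
    also have "\<dots> = joint q1 q2 m T z"
      by (rule joint_insert_sum[OF T]) (use s(1) par_s z m in auto)
    finally show ?thesis .
  qed
qed

lemma joint_pos:
  assumes z: "\<And>t. t \<in> G \<Longrightarrow> z t \<in> X t" and T: "T \<subseteq> G"
    and q1: "\<And>w. w \<in> PiE N X \<Longrightarrow> 0 < q1 w" and q2: "\<And>w. w \<in> PiE K X \<Longrightarrow> 0 < q2 w"
    and m: "\<And>s u v. \<lbrakk>s \<in> G; u \<in> PiE (par s) X; v \<in> X s\<rbrakk> \<Longrightarrow> 0 < m s u v"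
  shows "0 < joint q1 q2 m T z"
proof -
  have "0 < marginal X N q1 (T \<inter> N) z"
    by (rule marginal_pos) (use finG finite_subset N_G X_fin z q1 in auto)
  moreover have "0 < marginal X K q2 (unaffected z \<inter> T) z"
    by (rule marginal_pos) (use finG finite_subset K_G X_fin z q2 unaffected_subset[of z] in auto)
  moreover have "0 < m s (restrict z (par s)) (z s)" if "s \<in> T" for s
    using that T par_G z by (intro m restrict_in_PiE) auto
  ultimately show ?thesis unfolding joint_def by (auto intro!: mult_pos_pos prod_pos)
qed

lemma tendsto_joint:
  assumes z: "\<And>t. t \<in> G \<Longrightarrow> z t \<in> X t" and T: "T \<subseteq> G"
    and q1: "\<And>w. w \<in> PiE N X \<Longrightarrow> (\<lambda>n. q1 n w) \<longlonglongrightarrow> q1' w"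
    and q2: "\<And>w. w \<in> PiE K X \<Longrightarrow> (\<lambda>n. q2 n w) \<longlonglongrightarrow> q2' w"
    and m: "\<And>s u v. \<lbrakk>s \<in> G; u \<in> PiE (par s) X; v \<in> X s\<rbrakk> \<Longrightarrow> (\<lambda>n. m n s u v) \<longlonglongrightarrow> m' s u v"
  shows "(\<lambda>n. joint (q1 n) (q2 n) (m n) T z) \<longlonglongrightarrow> joint q1' q2' m' T z"
  unfolding joint_def marginal_def
proof (intro tendsto_mult tendsto_sum tendsto_prod)
  fix s assume s: "s \<in> T - N - unaffected z"
  show "(\<lambda>n. m n s (restrict z (par s)) (z s)) \<longlonglongrightarrow> m' s (restrict z (par s)) (z s)"
    by (intro m restrict_in_PiE z) (use s T par_G in auto)
qed (use q1 q2 cyl_subset in blast)+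

lemma sum_joint:
  assumes m: "\<And>s u. \<lbrakk>s \<in> G; u \<in> PiE (par s) X\<rbrakk> \<Longrightarrow> sum (m s u) (X s) = 1"
    and T: "ancestral par T" "T \<subseteq> G"
  shows "(\<Sum>z\<in>PiE G X. \<phi> (restrict z T) * joint q1 q2 m G z) = (\<Sum>u\<in>PiE T X. \<phi> u * joint q1 q2 m T u)"
proof -
  have "(\<Sum>u\<in>PiE T X. \<phi> u * joint q1 q2 m T u)
      = (\<Sum>u\<in>PiE T X. \<Sum>z\<in>{z \<in> PiE G X. restrict z T = u}. \<phi> (restrict z T) * joint q1 q2 m G z)"
  proof (rule sum.cong[OF refl])
    fix u assume u: "u \<in> PiE T X"
    have "restrict z T = u \<longleftrightarrow> (\<forall>t\<in>T. z t = u t)" for z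
      using PiE_arb[OF u] by (auto simp: fun_eq_iff restrict_def)
    then have c: "{z \<in> PiE G X. restrict z T = u} = cyl X G T u" by (simp add: cyl_def)
    have "joint q1 q2 m T u = sum (joint q1 q2 m G) {z \<in> PiE G X. restrict z T = u}"
      using marginal_joint[OF m T, where z = u] PiE_mem[OF u] unfolding marginal_def c by simp
    then show "\<phi> u * joint q1 q2 m T u
        = (\<Sum>z\<in>{z \<in> PiE G X. restrict z T = u}. \<phi> (restrict z T) * joint q1 q2 m G z)"
      by (simp add: sum_distrib_left)
  qed
  also have "\<dots> = (\<Sum>z\<in>PiE G X. \<phi> (restrict z T) * joint q1 q2 m G z)"
  proof (rule sum.group)
    show "(\<lambda>z. restrict z T) ` PiE G X \<subseteq> PiE T X"
    proof (intro image_subsetI restrict_in_PiE)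
      show "z t \<in> X t" if "z \<in> PiE G X" "t \<in> T" for z t using PiE_mem[OF that(1)] T(2) that(2) by auto
    qed
  qed (use fin_PiE T(2) in auto)
  finally show ?thesis by simp
qed

lemma sum_PiE_union:
  fixes a b :: "('n \<Rightarrow> 'v) \<Rightarrow> real"
  shows "(\<Sum>u\<in>PiE (N \<union> K) X. a (restrict u N) * b (restrict u K)) = (\<Sum>u\<in>PiE N X. a u) * (\<Sum>k\<in>PiE K X. b k)"
proof -
  have "(\<Sum>u\<in>PiE (N \<union> K) X. a (restrict u N) * b (restrict u K))
      = (\<Sum>(u, k)\<in>PiE N X \<times> PiE K X. a u * b k)"
  proof (rule sum.reindex_bij_witness[where j = "\<lambda>u. (restrict u N, restrict u K)"
        and i = "\<lambda>(u, k) t. if t \<in> N then u t else k t"])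
    fix w assume w: "w \<in> PiE (N \<union> K) X"
    show "(case (restrict w N, restrict w K) of (u, k) \<Rightarrow> \<lambda>t. if t \<in> N then u t else k t) = w"
      using PiE_arb[OF w] by (auto simp: fun_eq_iff restrict_def)
    show "(restrict w N, restrict w K) \<in> PiE N X \<times> PiE K X"
      using PiE_mem[OF w] by auto
  next
    fix p assume "p \<in> PiE N X \<times> PiE K X"
    then obtain u k where p: "p = (u, k)" "u \<in> PiE N X" "k \<in> PiE K X" by auto
    show "(restrict (case p of (u, k) \<Rightarrow> \<lambda>t. if t \<in> N then u t else k t) N,
        restrict (case p of (u, k) \<Rightarrow> \<lambda>t. if t \<in> N then u t else k t) K) = p"
      using PiE_arb[OF p(2)] PiE_arb[OF p(3)] NK unfolding p(1) by (fastforce simp: fun_eq_iff restrict_def)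
    show "(case p of (u, k) \<Rightarrow> \<lambda>t. if t \<in> N then u t else k t) \<in> PiE (N \<union> K) X"
      using PiE_mem[OF p(2)] PiE_mem[OF p(3)] PiE_arb[OF p(3)] unfolding p(1) by (intro PiE_I) auto
  qed auto
  then show ?thesis by (simp add: sum_product sum.cartesian_product)
qed

section \<open>Expectations and limiting conditionals of the glued measure\<close>

text \<open>The part with \<open>h\<close> sees only \<open>N\<close>, where the weight is
  \<open>q1\<close> because \<open>q2\<close> contributes its total mass 1. The part with
  \<open>g\<close> is supported where the parents of \<open>K\<close> have the value
  \<open>x\<close>; there every node of \<open>K\<close> is unaffected, and the weight on
  \<open>N \<union> K\<close> is the plain product of \<open>q1\<close> and
  \<open>q2\<close>.\<close>

lemma expectation_joint:
  assumes m: "\<And>s u. \<lbrakk>s \<in> G; u \<in> PiE (par s) X\<rbrakk> \<Longrightarrow> sum (m s u) (X s) = 1"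
    and q2: "sum q2 (PiE K X) = 1"
    and g: "\<And>u t. \<lbrakk>u \<in> PiE N X; g u \<noteq> 0; t \<in> parents_set par K\<rbrakk> \<Longrightarrow> x t = u t"
  shows "(\<Sum>z\<in>PiE G X. (h (restrict z N) + g (restrict z N) * f (restrict z K)) * joint q1 q2 m G z)
    = (\<Sum>u\<in>PiE N X. (h u + g u * (\<Sum>k\<in>PiE K X. f k * q2 k)) * q1 u)"
proof -
  let ?T = "N \<union> K"
  have T: "ancestral par ?T" "?T \<subseteq> G"
    using N_anc par_K N_G K_G by (auto simp: ancestral_def)
  have parK_N: "parents_set par K \<subseteq> N" using par_K by (auto simp: parents_set_def)
  have full: "marginal X S q S u = q (restrict u S)" if "\<And>t. t \<in> S \<Longrightarrow> u t \<in> X t" for S q u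
    using cyl_full[of S u X] that by (simp add: marginal_def)
  have joint_N: "joint q1 q2 m N u = q1 u" if u: "u \<in> PiE N X" for u
  proof -
    have "unaffected u \<inter> N = {}" using unaffected_subset NK by blast
    moreover have "restrict u N = u" using PiE_arb[OF u] by (auto simp: fun_eq_iff restrict_def)
    ultimately show ?thesis
      using full[of N u q1] PiE_mem[OF u] q2 by (simp add: joint_def marginal_def[of X K] cyl_empty)
  qed
  have joint_NK: "g (restrict u N) * f (restrict u K) * joint q1 q2 m ?T u
      = (g (restrict u N) * q1 (restrict u N)) * (f (restrict u K) * q2 (restrict u K))"
    if u: "u \<in> PiE ?T X" for u
  proof (cases "g (restrict u N) = 0")
    case False
    have r: "restrict u N \<in> PiE N X" by (rule restrict_in_PiE) (use PiE_mem[OF u] in auto)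
    have "u t = x t" if "t \<in> parents_set par K" for t
      using g[OF r False that] parK_N that by auto
    then have "unaffected u = K" by (auto simp: unaffected_def)
    then have "unaffected u \<inter> ?T = K" "?T \<inter> N = N" "?T - N - unaffected u = {}" by auto
    moreover have "marginal X N q1 N u = q1 (restrict u N)" "marginal X K q2 K u = q2 (restrict u K)"
      using full[of N u q1] full[of K u q2] PiE_mem[OF u] by auto
    ultimately have "joint q1 q2 m ?T u = q1 (restrict u N) * q2 (restrict u K)"
      unfolding joint_def by (simp only: prod.empty mult_1_right)
    then show ?thesis by simp
  qed simp
  have rr: "restrict (restrict z ?T) N = restrict z N" "restrict (restrict z ?T) K = restrict z K" for z :: "'n \<Rightarrow> 'v"
    by (auto simp: fun_eq_iff restrict_def)
  have "(\<Sum>z\<in>PiE G X. g (restrict z N) * f (restrict z K) * joint q1 q2 m G z)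
      = (\<Sum>u\<in>PiE ?T X. g (restrict u N) * f (restrict u K) * joint q1 q2 m ?T u)"
    using sum_joint[OF m T, where \<phi> = "\<lambda>u. g (restrict u N) * f (restrict u K)"] by (simp only: rr)
  also have "\<dots> = (\<Sum>u\<in>PiE ?T X. (g (restrict u N) * q1 (restrict u N)) * (f (restrict u K) * q2 (restrict u K)))"
    by (rule sum.cong[OF refl joint_NK])
  also have "\<dots> = (\<Sum>u\<in>PiE N X. g u * q1 u) * (\<Sum>k\<in>PiE K X. f k * q2 k)"
    by (rule sum_PiE_union)
  finally have g_part: "(\<Sum>z\<in>PiE G X. g (restrict z N) * f (restrict z K) * joint q1 q2 m G z)
      = (\<Sum>u\<in>PiE N X. g u * q1 u) * (\<Sum>k\<in>PiE K X. f k * q2 k)" .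
  have "(\<Sum>z\<in>PiE G X. h (restrict z N) * joint q1 q2 m G z) = (\<Sum>u\<in>PiE N X. h u * joint q1 q2 m N u)"
    by (rule sum_joint[OF m N_anc N_G])
  also have "\<dots> = (\<Sum>u\<in>PiE N X. h u * q1 u)" using joint_N by simp
  finally have h_part: "(\<Sum>z\<in>PiE G X. h (restrict z N) * joint q1 q2 m G z) = (\<Sum>u\<in>PiE N X. h u * q1 u)" .
  define c where "c = (\<Sum>k\<in>PiE K X. f k * q2 k)"
  have "(\<Sum>z\<in>PiE G X. (h (restrict z N) + g (restrict z N) * f (restrict z K)) * joint q1 q2 m G z)
      = (\<Sum>u\<in>PiE N X. h u * q1 u) + (\<Sum>u\<in>PiE N X. g u * q1 u) * c"
    by (simp only: distrib_right sum.distrib h_part g_part c_def)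
  also have "\<dots> = (\<Sum>u\<in>PiE N X. (h u + g u * c) * q1 u)"
    unfolding sum_distrib_right sum.distrib[symmetric] by (rule sum.cong) (simp_all add: algebra_simps)
  finally show ?thesis unfolding c_def .
qed

text \<open>In the quotient all factors free of \<open>X_s\<close> cancel, leaving a conditional of
  \<open>q1\<close>, a conditional of \<open>q2\<close> or one local model, according to the three
  kinds of nodes. Its limit is a conditional of \<open>P1\<close> or \<open>P2\<close>, even on a
  null event, or a value of \<open>m\<close>; hence it lies in the local credal set.\<close>

lemma conditional_limit:
  assumes P1: "P1 \<in> irr_ext par X M N y1" and P2: "P2 \<in> irr_ext par X M K x"
    and q1: "positive_approx (PiE N X) P1 q1" and q2: "positive_approx (PiE K X) P2 q2"
    and m: "\<And>s u. \<lbrakk>s \<in> G; u \<in> PiE (par s) X\<rbrakk> \<Longrightarrow> m s u \<in> M s u"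
    and mm: "\<And>n s u v. \<lbrakk>s \<in> G; u \<in> PiE (par s) X; v \<in> X s\<rbrakk> \<Longrightarrow> 0 < mm n s u v"
      "\<And>s u v. \<lbrakk>s \<in> G; u \<in> PiE (par s) X; v \<in> X s\<rbrakk> \<Longrightarrow> (\<lambda>n. mm n s u v) \<longlonglongrightarrow> m s u v"
    and s: "s \<in> G" and z: "z \<in> PiE G X"
  shows "\<exists>p\<in>M s (restrict z (par s)). \<forall>v\<in>X s.
    (\<lambda>n. joint (q1 n) (q2 n) (mm n) (insert s (nondesc_on par G s)) (z(s := v))
       / joint (q1 n) (q2 n) (mm n) (nondesc_on par G s) z) \<longlonglongrightarrow> p v"
proof -
  let ?T = "nondesc_on par G s"
  have T: "ancestral par ?T" "?T \<subseteq> G" "s \<notin> ?T" "par s \<subseteq> ?T"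
    using nondesc_ancestral par_nondesc[OF s] by (auto simp: nondesc_on_def)
  note ins = T(1,2) s T(3,4)
  have zX: "z t \<in> X t" if "t \<in> G" for t using PiE_mem[OF z that] .
  have restrict_par: "restrict z (par s) \<in> PiE (par s) X"
    by (rule restrict_in_PiE) (use zX par_G[OF s] in auto)
  have pos: "0 < joint (q1 n) (q2 n) (mm n) ?T z" for n
    by (rule joint_pos) (use zX T(2) positive_approx_pos[OF q1] positive_approx_pos[OF q2] mm(1) in auto)
  have rN: "restrict z N \<in> PiE N X" and rK: "restrict z K \<in> PiE K X"
    using zX N_G K_G by auto
  consider "s \<in> N" | "s \<in> unaffected z" | "s \<notin> N" "s \<notin> unaffected z" by blast
  then show ?thesis
  proof cases
    case 1
    have cyl: "cyl X N (?T \<inter> N) (restrict z N) = cyl X N (?T \<inter> N) z"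
      by (rule cyl_cong) auto
    have ne: "cyl X N (?T \<inter> N) z \<noteq> {}" using restrict_in_cyl[of N z X "?T \<inter> N"] zX N_G by auto
    have par_N: "par s \<subseteq> N" using N_anc 1 by (auto simp: ancestral_def)
    have mem: "(\<lambda>v. P1 {w \<in> PiE N X. w s = v} (cyl X N (?T \<inter> N) (restrict z N)))
       \<in> M s (restrict (\<lambda>t. if t \<in> N then restrict z N t else y1 t) (par s))"
    proof (rule irr_ext_coarser[OF N_G P1 _ 1 _ _ rN])
      show "?T \<inter> N \<subseteq> nondesc_on par N s"
        using nondesc_on_closed[OF N_G ancestral_closed_nodes[OF N_anc] 1] by simp
      show "par s \<inter> N \<subseteq> ?T \<inter> N" using T(4) by auto
      show "y1 t \<in> X t" if "s \<in> N" "t \<in> par s - N" for s t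
        using that N_anc by (auto simp: ancestral_def)
    qed
    have res: "restrict (\<lambda>t. if t \<in> N then restrict z N t else y1 t) (par s) = restrict z (par s)"
      by (rule restrict_ext) (use par_N in auto)
    have "(\<lambda>n. joint (q1 n) (q2 n) (mm n) (insert s ?T) (z(s := v)) / joint (q1 n) (q2 n) (mm n) ?T z)
       \<longlonglongrightarrow> P1 {w \<in> PiE N X. w s = v} (cyl X N (?T \<inter> N) z)" for v
    proof -
      define R where "R n = marginal X K (q2 n) (unaffected z \<inter> ?T) z
        * (\<Prod>t\<in>?T - N - unaffected z. mm n t (restrict z (par t)) (z t))" for n
      have split: "joint (q1 n) (q2 n) (mm n) ?T z = marginal X N (q1 n) (?T \<inter> N) z * R n" for n
        by (simp add: joint_def R_def mult.assoc)
      have ins_v: "joint (q1 n) (q2 n) (mm n) (insert s ?T) (z(s := v))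
          = marginal X N (q1 n) (insert s (?T \<inter> N)) (z(s := v)) * R n" for n
        unfolding R_def by (rule joint_insert_N[OF ins 1])
      have "R n \<noteq> 0" for n using pos[of n] unfolding split by auto
      then have "joint (q1 n) (q2 n) (mm n) (insert s ?T) (z(s := v)) / joint (q1 n) (q2 n) (mm n) ?T z
         = sum (q1 n) ({w \<in> PiE N X. w s = v} \<inter> cyl X N (?T \<inter> N) z) / sum (q1 n) (cyl X N (?T \<inter> N) z)" for n
        unfolding split ins_v using T(3)
        by (simp add: marginal_def cyl_insert_upd)
      then show ?thesis using positive_approx_lim[OF q1 _ cyl_subset ne, of "{w \<in> PiE N X. w s = v}"] by simp
    qed
    then show ?thesis using mem unfolding cyl res by (intro bexI[OF _ mem[unfolded cyl res]]) blast
  next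
    case 2
    let ?U = "unaffected z \<inter> ?T"
    have sK: "s \<in> K" using 2 unaffected_subset by blast
    have cyl: "cyl X K ?U (restrict z K) = cyl X K ?U z"
      by (rule cyl_cong) (use unaffected_subset[of z] in auto)
    have ne: "cyl X K ?U z \<noteq> {}"
      using restrict_in_cyl[of K z X ?U] zX K_G unaffected_subset[of z] by auto
    have edge: "(t, s) \<in> edges_on par G" if "t \<in> par s" for t
      using that s par_G[OF s] by (auto simp: edges_on_def)
    have mem: "(\<lambda>v. P2 {w \<in> PiE K X. w s = v} (cyl X K ?U (restrict z K)))
       \<in> M s (restrict (\<lambda>t. if t \<in> K then restrict z K t else x t) (par s))"
    proof (rule irr_ext_coarser[OF K_G P2 _ sK _ _ rK])
      \<comment> \<open>The inclusion can be strict, since affected nodes of \<open>K\<close> may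
        also be nondescendants of \<open>s\<close>. This is where conditioning on fewer than all
        nondescendants is essential.\<close>
      show "?U \<subseteq> nondesc_on par K s"
        using nondesc_on_closed[OF K_G K_closed sK] unaffected_subset[of z] by auto
      \<comment> \<open>Parents in \<open>K\<close> of an unaffected node are unaffected, because
        their ancestors are ancestors of \<open>s\<close> too.\<close>
      show "par s \<inter> K \<subseteq> ?U"
      proof
        fix k assume k: "k \<in> par s \<inter> K"
        have "z p = x p" if "p \<in> parents_set par K" "k \<in> desc_on par G p" for p
        proof -
          have "s \<in> desc_on par G p"
            using that(2) edge[of k] k unfolding desc_on_def by (auto intro: trancl_into_trancl)
          then show ?thesis using 2 that(1) by (auto simp: unaffected_def)
        qed
        then show "k \<in> ?U" using k T(4) by (auto simp: unaffected_def)
      qed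
      show "x t \<in> X t" if "s \<in> K" "t \<in> par s - K" for s t
        by (rule x_in) (use that in \<open>auto simp: parents_set_def\<close>)
    qed
    \<comment> \<open>A parent of \<open>s\<close> outside \<open>K\<close> is a parent of
      \<open>K\<close> with \<open>s\<close> as descendant. As \<open>s\<close> is unaffected,
      \<open>z\<close> has the value \<open>x\<close> there, which is the value that the local
      models of \<open>P2\<close> are taken at.\<close>
    have res: "restrict (\<lambda>t. if t \<in> K then restrict z K t else x t) (par s) = restrict z (par s)"
    proof (rule restrict_ext)
      fix t assume t: "t \<in> par s"
      have "z t = x t" if "t \<notin> K"
      proof -
        have "t \<in> parents_set par K" using t that sK by (auto simp: parents_set_def)
        moreover have "s \<in> desc_on par G t" using edge[OF t] by (auto simp: desc_on_def)
        ultimately show ?thesis using 2 by (auto simp: unaffected_def)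
      qed
      then show "(if t \<in> K then restrict z K t else x t) = z t" by auto
    qed
    have "(\<lambda>n. joint (q1 n) (q2 n) (mm n) (insert s ?T) (z(s := v)) / joint (q1 n) (q2 n) (mm n) ?T z)
       \<longlonglongrightarrow> P2 {w \<in> PiE K X. w s = v} (cyl X K ?U z)" for v
    proof -
      define R where "R n = marginal X N (q1 n) (?T \<inter> N) z
        * (\<Prod>t\<in>?T - N - unaffected z. mm n t (restrict z (par t)) (z t))" for n
      have split: "joint (q1 n) (q2 n) (mm n) ?T z = marginal X K (q2 n) ?U z * R n" for n
        by (simp add: joint_def R_def mult_ac)
      have ins_v: "joint (q1 n) (q2 n) (mm n) (insert s ?T) (z(s := v))
          = marginal X K (q2 n) (insert s ?U) (z(s := v)) * R n" for n
        unfolding R_def by (rule joint_insert_unaffected[OF ins 2])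
      have "R n \<noteq> 0" for n using pos[of n] unfolding split by auto
      then have "joint (q1 n) (q2 n) (mm n) (insert s ?T) (z(s := v)) / joint (q1 n) (q2 n) (mm n) ?T z
         = sum (q2 n) ({w \<in> PiE K X. w s = v} \<inter> cyl X K ?U z) / sum (q2 n) (cyl X K ?U z)" for n
        unfolding split ins_v using T(3)
        by (simp add: marginal_def cyl_insert_upd)
      then show ?thesis using positive_approx_lim[OF q2 _ cyl_subset ne, of "{w \<in> PiE K X. w s = v}"] by simp
    qed
    then show ?thesis using mem unfolding cyl res by (intro bexI[OF _ mem[unfolded cyl res]]) blast
  next
    case 3
    have "joint (q1 n) (q2 n) (mm n) (insert s ?T) (z(s := v)) / joint (q1 n) (q2 n) (mm n) ?T z
        = mm n s (restrict z (par s)) v" for n v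
      unfolding joint_insert_other[OF ins 3] using pos[of n] by simp
    then show ?thesis using m[OF s restrict_par] mm(2)[OF s restrict_par] by auto
  qed
qed

text \<open>The conditionals of \<open>P\<close> are obtained as limits, but its unconditional
  masses are explicit: \<open>joint\<close> is continuous in its finitely many inputs, so
  \<open>P1\<close>, \<open>P2\<close> and \<open>m\<close> themselves may be inserted, zeros
  included.\<close>

lemma glued_extension_exists:
  assumes P1: "P1 \<in> irr_ext par X M N y1" and P2: "P2 \<in> irr_ext par X M K x"
    and m: "\<And>s u. \<lbrakk>s \<in> G; u \<in> PiE (par s) X\<rbrakk> \<Longrightarrow> m s u \<in> M s u"
  obtains P where "P \<in> irr_ext par X M G y0"
    "\<And>z. z \<in> PiE G X \<Longrightarrow>
       P {z} (PiE G X) = joint (\<lambda>w. P1 {w} (PiE N X)) (\<lambda>w. P2 {w} (PiE K X)) m G z"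
proof -
  let ?\<Omega> = "PiE G X"
  have fc1: "full_cond_prob (PiE N X) P1" and fc2: "full_cond_prob (PiE K X) P2"
    using P1 P2 by (auto simp: irr_ext_def)
  obtain q1 where q1: "positive_approx (PiE N X) P1 q1"
    "\<And>w. w \<in> PiE N X \<Longrightarrow> (\<lambda>n. q1 n w) \<longlonglongrightarrow> P1 {w} (PiE N X)"
    using fcp_positive_approx_normalised[OF fin_PiE[OF N_G] fc1] by blast
  obtain q2 where q2: "positive_approx (PiE K X) P2 q2"
    "\<And>w. w \<in> PiE K X \<Longrightarrow> (\<lambda>n. q2 n w) \<longlonglongrightarrow> P2 {w} (PiE K X)"
    using fcp_positive_approx_normalised[OF fin_PiE[OF K_G] fc2] by blast
  have m_pmf: "pmf_on (X s) (m s u)" if "s \<in> G" "u \<in> PiE (par s) X" for s u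
    using M_pmf[OF that m[OF that]] .
  have m_sum: "sum (m s u) (X s) = 1" if "s \<in> G" "u \<in> PiE (par s) X" for s u
    using m_pmf[OF that] by (simp add: pmf_on_def)
  define e where "e n = inverse (real (Suc n))" for n
  have e: "0 < e n" "e \<longlonglongrightarrow> 0" for n
    unfolding e_def using LIMSEQ_inverse_real_of_nat by auto
  \<comment> \<open>Mass \<open>e n\<close> is added to every state and the result renormalised. The
    perturbed models need not lie in \<open>M\<close>; only their limits \<open>m\<close> have
    to.\<close>
  define mm where "mm n s u v = (m s u v + e n) / (1 + e n * real (card (X s)))" for n s u v
  have den: "0 < 1 + e n * real (card (X s))" for n s
    using e(1)[of n] by (intro add_pos_nonneg) auto
  have mm_pos: "0 < mm n s u v" if "s \<in> G" "u \<in> PiE (par s) X" "v \<in> X s" for n s u v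
    unfolding mm_def using m_pmf[OF that(1,2)] that(3) e(1)[of n] den[of n s]
    by (intro divide_pos_pos) (auto simp: pmf_on_def intro: add_nonneg_pos)
  have mm_lim: "(\<lambda>n. mm n s u v) \<longlonglongrightarrow> m s u v" if "s \<in> G" "u \<in> PiE (par s) X" "v \<in> X s" for s u v
  proof -
    have "(\<lambda>n. mm n s u v) \<longlonglongrightarrow> (m s u v + 0) / (1 + 0 * real (card (X s)))"
      unfolding mm_def by (intro tendsto_intros e(2)) simp
    then show ?thesis by simp
  qed
  have mm_sum: "sum (mm n s u) (X s) = 1" if "s \<in> G" "u \<in> PiE (par s) X" for n s u
    using m_sum[OF that] den[of n s]
    by (simp add: mm_def sum.distrib mult.commute flip: sum_divide_distrib)
  define W where "W n = joint (q1 n) (q2 n) (mm n)" for n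
  have W_pos: "0 < W n G z" if "z \<in> ?\<Omega>" for n z
    unfolding W_def by (rule joint_pos) (use PiE_mem[OF that] positive_approx_pos[OF q1(1)] positive_approx_pos[OF q2(1)] mm_pos in auto)
  obtain P r where P: "full_cond_prob ?\<Omega> P" and r: "strict_mono r"
    and "positive_approx ?\<Omega> P (\<lambda>n. W (r n) G)"
    using fcp_limit_of_positive[OF fin_PiE[OF order_refl], where w = "\<lambda>n. W n G", OF W_pos] by blast
  note P_lim = positive_approx_lim[OF this(3)]
  have marg: "sum (W n G) (cyl X G T z) = W n T z"
    if "ancestral par T" "T \<subseteq> G" "\<And>t. t \<in> T \<Longrightarrow> z t \<in> X t" for n T z
    using marginal_joint[where m = "mm n" and T = T and z = z] mm_sum that unfolding W_def marginal_def by simp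
  have "P \<in> irr_ext par X M G y0"
    unfolding irr_ext_def
  proof (intro CollectI conjI ballI P)
    fix s z assume s: "s \<in> G" and z: "z \<in> ?\<Omega>"
    let ?T = "nondesc_on par G s"
    have T: "ancestral par ?T" "?T \<subseteq> G" "s \<notin> ?T" "par s \<subseteq> ?T"
      using nondesc_ancestral par_nondesc[OF s] by (auto simp: nondesc_on_def)
    have ins: "ancestral par (insert s ?T)" using T(1,4) by (auto simp: ancestral_def)
    obtain p where p: "p \<in> M s (restrict z (par s))"
      and lim: "\<And>v. v \<in> X s \<Longrightarrow> (\<lambda>n. W n (insert s ?T) (z(s := v)) / W n ?T z) \<longlonglongrightarrow> p v"
      using conditional_limit[OF P1 P2 q1(1) q2(1) m mm_pos mm_lim s z] unfolding W_def by blast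
    have ne: "cyl X G ?T z \<noteq> {}" using z by (auto simp: cyl_def)
    have "P {w \<in> ?\<Omega>. w s = v} (cyl X G ?T z) = p v" for v
    proof (cases "v \<in> X s")
      case True
      have "sum (W n G) ({w \<in> ?\<Omega>. w s = v} \<inter> cyl X G ?T z) = W n (insert s ?T) (z(s := v))" for n
        unfolding cyl_insert_upd[OF T(3), symmetric]
        by (rule marg[OF ins]) (use s T(2) True PiE_mem[OF z] in auto)
      moreover have "sum (W n G) (cyl X G ?T z) = W n ?T z" for n
        by (rule marg[OF T(1,2)]) (use T(2) PiE_mem[OF z] in auto)
      ultimately have "(\<lambda>n. W (r n) (insert s ?T) (z(s := v)) / W (r n) ?T z)
          \<longlonglongrightarrow> P {w \<in> ?\<Omega>. w s = v} (cyl X G ?T z)"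
        using P_lim[OF _ cyl_subset ne, of "{w \<in> ?\<Omega>. w s = v}"] by simp
      moreover have "(\<lambda>n. W (r n) (insert s ?T) (z(s := v)) / W (r n) ?T z) \<longlonglongrightarrow> p v"
        using LIMSEQ_subseq_LIMSEQ[OF lim[OF True] r] by (simp add: o_def)
      ultimately show ?thesis by (rule LIMSEQ_unique)
    next
      \<comment> \<open>Outside the state space the event is empty, and the mass functions in
        \<open>M\<close> vanish there, so both sides are zero.\<close>
      case False
      then have no_v: "{w \<in> ?\<Omega>. w s = v} = {}" using PiE_mem s by fastforce
      have "pmf_on (X s) p"
        by (rule M_pmf[OF s restrict_in_PiE p]) (use PiE_mem[OF z] par_G[OF s] in auto)
      then show ?thesis unfolding no_v using fcp_empty[OF P cyl_subset ne] False by (simp add: pmf_on_def)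
    qed
    moreover have "restrict (\<lambda>t. if t \<in> G then z t else y0 t) (par s) = restrict z (par s)"
      by (rule restrict_ext) (use par_G[OF s] in auto)
    ultimately show "(\<lambda>v. P {w \<in> ?\<Omega>. w s = v} {w \<in> ?\<Omega>. \<forall>t\<in>?T. w t = z t})
        \<in> M s (restrict (\<lambda>t. if t \<in> G then z t else y0 t) (par s))"
      using p by (simp add: cyl_def)
  qed
  moreover have "P {z} ?\<Omega> = joint (\<lambda>w. P1 {w} (PiE N X)) (\<lambda>w. P2 {w} (PiE K X)) m G z"
    if z: "z \<in> ?\<Omega>" for z
  proof -
    let ?J = "joint (\<lambda>w. P1 {w} (PiE N X)) (\<lambda>w. P2 {w} (PiE K X)) m"
    have W_lim: "(\<lambda>n. W n T z) \<longlonglongrightarrow> ?J T z" if "T \<subseteq> G" for T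
      unfolding W_def by (rule tendsto_joint) (use PiE_mem[OF z] that q1(2) q2(2) mm_lim in auto)
    \<comment> \<open>The value at the empty set is the total weight. Its limit 1 allows the
      normalising denominators to be dropped in the limit.\<close>
    have "?J {} z = 1"
      using fcp_sum[OF fc1 fin_PiE[OF N_G] order_refl order_refl PiE_ne[OF N_G]]
        fcp_sum[OF fc2 fin_PiE[OF K_G] order_refl order_refl PiE_ne[OF K_G]]
        fcp_self[OF fc1 order_refl PiE_ne[OF N_G]] fcp_self[OF fc2 order_refl PiE_ne[OF K_G]]
      by (simp add: joint_def marginal_def cyl_empty)
    then have "(\<lambda>n. W n G z / W n {} z) \<longlonglongrightarrow> ?J G z"
      using tendsto_divide[OF W_lim[of G] W_lim[of "{}"]] by simp
    then have "(\<lambda>n. W (r n) G z / W (r n) {} z) \<longlonglongrightarrow> ?J G z"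
      using LIMSEQ_subseq_LIMSEQ[OF _ r] by (fastforce simp: o_def)
    moreover have "sum (W n G) ?\<Omega> = W n {} z" for n
      using marg[where T = "{}" and z = z and n = n] by (simp add: ancestral_def cyl_empty)
    then have "(\<lambda>n. W (r n) G z / W (r n) {} z) \<longlonglongrightarrow> P {z} ?\<Omega>"
      using P_lim[of "{z}" ?\<Omega>] z by auto
    ultimately show ?thesis using LIMSEQ_unique by blast
  qed
  ultimately show ?thesis by (rule that)
qed

end

section \<open>Nonemptiness of the extensions\<close>

text \<open>With no nodes there is one assignment and no local constraint, so the point mass
  qualifies. It supplies both factors for the gluing that proves \<open>irr_ext_ne\<close>.\<close>

lemma irr_ext_no_nodes: "irr_ext par X M {} y \<noteq> {}"
proof -
  have "full_cond_prob (PiE {} X) (\<lambda>A B. if (\<lambda>_. undefined) \<in> A then 1 else 0)"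
    unfolding full_cond_prob_def by auto
  then show ?thesis unfolding irr_ext_def by blast
qed

context credal_network
begin

lemma local_choice: "\<exists>m. \<forall>s\<in>G. \<forall>u\<in>PiE (par s) X. m s u \<in> M s u"
  using M_ne by (intro exI[of _ "\<lambda>s u. SOME p. p \<in> M s u"]) (simp add: some_in_eq)

text \<open>Gluing with both \<open>N\<close> and \<open>K\<close> empty leaves the local models as
  the only nontrivial factors, so the construction yields a member of the extension from any choice
  of local models. Nonemptiness is needed to bound the infima from below.\<close>

lemma irr_ext_ne: "irr_ext par X M G y \<noteq> {}"
proof -
  interpret none: gluing par X M G "{}" "{}" x
    by unfold_locales (auto simp: ancestral_def closed_nodes_def parents_set_def)
  obtain m where m: "\<And>s u. \<lbrakk>s \<in> G; u \<in> PiE (par s) X\<rbrakk> \<Longrightarrow> m s u \<in> M s u"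
    using local_choice by blast
  obtain P1 where "P1 \<in> irr_ext par X M {} x" using irr_ext_no_nodes by blast
  then show ?thesis using none.glued_extension_exists[OF _ _ m] by blast
qed

end

context gluing
begin

lemma N_ext_ne: "irr_ext par X M N y \<noteq> {}"
proof -
  obtain P where P: "P \<in> irr_ext par X M G y" using irr_ext_ne by blast
  obtain w where w: "w \<in> PiE G X" using PiE_ne by blast
  show ?thesis
    using conditional_irr_ext[OF P N_G ancestral_closed_nodes[OF N_anc], of "{}" w y] w N_anc
    by (auto simp: ancestral_def parents_set_def)
qed

lemma K_ext_ne: "irr_ext par X M K x \<noteq> {}"
proof -
  obtain P where P: "P \<in> irr_ext par X M G x" using irr_ext_ne by blast
  obtain w where w: "w \<in> PiE G X" using PiE_ne by blast
  have parK: "parents_set par K \<subseteq> G" using par_K N_G K_G by (auto simp: parents_set_def)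
  \<comment> \<open>The conditioning value has to agree with \<open>x\<close> on the parents of
    \<open>K\<close>; elsewhere any admissible value will do.\<close>
  define y where "y t = (if t \<in> parents_set par K then x t else w t)" for t
  have y: "y \<in> PiE G X"
  proof (rule PiE_I)
    show "y t \<in> X t" if "t \<in> G" for t using that x_in PiE_mem[OF w] by (auto simp: y_def)
    show "y t = undefined" if "t \<notin> G" for t using that parK PiE_arb[OF w] by (auto simp: y_def)
  qed
  have desc: "N \<inter> desc_on par G s = {}" if "s \<in> K" for s
    using ancestral_trancl[OF N_anc] that NK unfolding desc_on_def by blast
  have "(\<lambda>A B. P {w \<in> cyl X G N y. restrict w K \<in> A} {w \<in> cyl X G N y. restrict w K \<in> B})
      \<in> irr_ext par X M K x"
    by (rule conditional_irr_ext[OF P K_G K_closed N_G NK par_K desc y]) (simp_all add: y_def)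
  then show ?thesis by blast
qed

section \<open>The upper bound and the equality\<close>

text \<open>For a fixed \<open>P1\<close> the glued measures have expectation
  \<open>a + b * c\<close>, where \<open>c\<close> is the expectation of \<open>f\<close> under
  \<open>P2\<close> and \<open>b\<close> is non-negative. Taking the infimum over \<open>P2\<close>
  inside this affine expression, and then over \<open>P1\<close>, gives the bound.\<close>

lemma lower_exp_le_glued:
  assumes g: "\<And>u. u \<in> PiE N X \<Longrightarrow> 0 \<le> g u"
      "\<And>u t. \<lbrakk>u \<in> PiE N X; g u \<noteq> 0; t \<in> parents_set par K\<rbrakk> \<Longrightarrow> x t = u t"
  shows "lower_exp_irr par X M G y0 (\<lambda>z. h (restrict z N) + g (restrict z N) * f (restrict z K))
    \<le> lower_exp_irr par X M N y1 (\<lambda>u. h u + g u * lower_exp_irr par X M K x f)"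
    (is "?lhs \<le> _")
proof (rule lower_exp_greatest[OF N_ext_ne])
  fix P1 assume P1: "P1 \<in> irr_ext par X M N y1"
  define a where "a = (\<Sum>u\<in>PiE N X. h u * P1 {u} (PiE N X))"
  define b where "b = (\<Sum>u\<in>PiE N X. g u * P1 {u} (PiE N X))"
  have "full_cond_prob (PiE N X) P1" using P1 by (simp add: irr_ext_def)
  then have b: "0 \<le> b" unfolding b_def
    by (intro sum_nonneg mult_nonneg_nonneg g(1) fcp_nonneg) (use PiE_ne[OF N_G] in auto)
  have affine: "(\<Sum>u\<in>PiE N X. (h u + g u * c) * P1 {u} (PiE N X)) = a + b * c" for c
    unfolding a_def b_def sum_distrib_right sum.distrib[symmetric]
    by (rule sum.cong) (simp_all add: algebra_simps)
  obtain m where m: "\<And>s u. \<lbrakk>s \<in> G; u \<in> PiE (par s) X\<rbrakk> \<Longrightarrow> m s u \<in> M s u"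
    using local_choice by blast
  have m_sum: "sum (m s u) (X s) = 1" if "s \<in> G" "u \<in> PiE (par s) X" for s u
    using M_pmf[OF that m[OF that]] by (simp add: pmf_on_def)
  have le: "?lhs \<le> a + b * expect P2 K f" if P2: "P2 \<in> irr_ext par X M K x" for P2
  proof -
    have fc2: "full_cond_prob (PiE K X) P2" using P2 by (simp add: irr_ext_def)
    have tot: "(\<Sum>k\<in>PiE K X. P2 {k} (PiE K X)) = 1"
      using fcp_sum[OF fc2 fin_PiE[OF K_G] order_refl order_refl PiE_ne[OF K_G]]
        fcp_self[OF fc2 order_refl PiE_ne[OF K_G]] by simp
    obtain P where P: "P \<in> irr_ext par X M G y0" and
      P_eq: "\<And>z. z \<in> PiE G X \<Longrightarrow>
         P {z} (PiE G X) = joint (\<lambda>w. P1 {w} (PiE N X)) (\<lambda>w. P2 {w} (PiE K X)) m G z"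
      using glued_extension_exists[OF P1 P2 m] by blast
    have "?lhs \<le> expect P G (\<lambda>z. h (restrict z N) + g (restrict z N) * f (restrict z K))"
      by (rule lower_exp_le[OF order_refl P])
    also have "\<dots> = (\<Sum>z\<in>PiE G X. (h (restrict z N) + g (restrict z N) * f (restrict z K))
        * joint (\<lambda>w. P1 {w} (PiE N X)) (\<lambda>w. P2 {w} (PiE K X)) m G z)"
      by (intro sum.cong refl) (simp only: P_eq)
    also have "\<dots> = (\<Sum>u\<in>PiE N X. (h u + g u * expect P2 K f) * P1 {u} (PiE N X))"
      by (rule expectation_joint) (fact m_sum tot g(2))+
    also have "\<dots> = a + b * expect P2 K f" by (rule affine)
    finally show ?thesis .
  qed
  have "?lhs \<le> a + b * lower_exp_irr par X M K x f"
  \<comment> \<open>For \<open>b = 0\<close> the bound does not depend on \<open>P2\<close>, and any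
    one member of the extension on \<open>K\<close> is enough; otherwise division by
    \<open>b\<close> turns it into a lower bound for all expectations of \<open>f\<close>.\<close>
  proof (cases "b = 0")
    case True
    then show ?thesis using le K_ext_ne by auto
  next
    case False
    with b have "0 < b" by simp
    then have "(?lhs - a) / b \<le> lower_exp_irr par X M K x f"
      by (intro lower_exp_greatest[OF K_ext_ne]) (use le in \<open>simp add: pos_divide_le_eq algebra_simps\<close>)
    with \<open>0 < b\<close> show ?thesis by (simp add: pos_divide_le_eq algebra_simps)
  qed
  then show "?lhs \<le> expect P1 N (\<lambda>u. h u + g u * lower_exp_irr par X M K x f)"
    by (simp only: affine)
qed

lemma lower_exp_glued:
  assumes g: "\<And>u. u \<in> PiE N X \<Longrightarrow> 0 \<le> g u"
      "\<And>u t. \<lbrakk>u \<in> PiE N X; g u \<noteq> 0; t \<in> parents_set par K\<rbrakk> \<Longrightarrow> x t = u t"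
  shows "lower_exp_irr par X M G y0 (\<lambda>z. h (restrict z N) + g (restrict z N) * f (restrict z K))
    = lower_exp_irr par X M N y1 (\<lambda>u. h u + g u * lower_exp_irr par X M K x f)"
proof (rule antisym)
  show "lower_exp_irr par X M N y1 (\<lambda>u. h u + g u * lower_exp_irr par X M K x f)
      \<le> lower_exp_irr par X M G y0 (\<lambda>z. h (restrict z N) + g (restrict z N) * f (restrict z K))"
    by (rule lower_exp_greatest[OF irr_ext_ne],
        rule expect_ge_lower_exp[OF _ N_G N_anc K_G K_closed NK par_K]) (use g in blast)+
  show "lower_exp_irr par X M G y0 (\<lambda>z. h (restrict z N) + g (restrict z N) * f (restrict z K))
      \<le> lower_exp_irr par X M N y1 (\<lambda>u. h u + g u * lower_exp_irr par X M K x f)"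
    by (rule lower_exp_le_glued) (fact g)+
qed

end

theorem theorem4:
  fixes par :: "'n \<Rightarrow> 'n set" and X :: "'n \<Rightarrow> 'v set"
    and M :: "'n \<Rightarrow> ('n \<Rightarrow> 'v) \<Rightarrow> ('v \<Rightarrow> real) set"
    and G K :: "'n set" and x :: "'n \<Rightarrow> 'v"
    and f h g :: "('n \<Rightarrow> 'v) \<Rightarrow> real"
  assumes finG: "finite G"
    and X_fin: "\<forall>s\<in>G. finite (X s) \<and> X s \<noteq> {}"
    and par_G: "\<forall>s\<in>G. par s \<subseteq> G"
    and dag: "acyclic (edges_on par G)"
    and local_models: "\<forall>s\<in>G. \<forall>u\<in>PiE (par s) X.
          M s u \<noteq> {} \<and> closed (M s u) \<and> convex_fun_set (M s u) \<and> (\<forall>p\<in>M s u. pmf_on (X s) p)"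
    and KG: "K \<subseteq> G"
    and K_closed: "closed_nodes par G K"
    and x_in: "x \<in> PiE (parents_set par K) X"
    and g_nonneg: "\<forall>z\<in>PiE (nondesc_nonpar_set par G K) X. 0 \<le> g z"
  shows "lower_exp_irr par X M G (\<lambda>_. undefined)
           (\<lambda>z. h (restrict z (nondesc_set par G K))
                + g (restrict z (nondesc_nonpar_set par G K))
                  * (if restrict z (parents_set par K) = x then 1 else 0)
                  * f (restrict z K))
       = lower_exp_irr par X M (nondesc_set par G K) (\<lambda>_. undefined)
           (\<lambda>z. h (restrict z (nondesc_set par G K))
                + g (restrict z (nondesc_nonpar_set par G K))
                  * (if restrict z (parents_set par K) = x then 1 else 0)
                  * lower_exp_irr par X M K x f)"
proof -
  let ?N = "nondesc_set par G K" and ?N' = "nondesc_nonpar_set par G K" and ?PK = "parents_set par K"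
  have PK_N: "?PK \<subseteq> ?N" by (rule closed_parents_subset_nondesc[OF par_G KG K_closed])
  have N_anc: "ancestral par ?N" by (rule nondesc_set_ancestral[OF par_G KG])
  interpret credal_network par X M G
    using finG X_fin par_G dag local_models by unfold_locales blast+
  interpret gluing par X M G ?N K x
  proof
    show "?N \<subseteq> G" "?N \<inter> K = {}" by (auto simp: nondesc_set_def)
    show "par s \<subseteq> K \<union> ?N" if "s \<in> K" for s using PK_N that by (auto simp: parents_set_def)
    show "x t \<in> X t" if "t \<in> ?PK" for t using PiE_mem[OF x_in that] .
  qed (fact KG K_closed N_anc)+
  \<comment> \<open>The indicator is merged with \<open>g\<close> into one non-negative function of
    \<open>X_N(K)\<close>. That it is nonzero only where the parents of \<open>K\<close> have the
    value \<open>x\<close> is the form in which the gluing lemmas use the indicator.\<close>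
  define G1 where "G1 z = g (restrict z ?N') * (if restrict z ?PK = x then 1 else 0)" for z
  have "lower_exp_irr par X M G (\<lambda>_. undefined)
         (\<lambda>z. h (restrict (restrict z ?N) ?N) + G1 (restrict z ?N) * f (restrict z K))
      = lower_exp_irr par X M ?N (\<lambda>_. undefined)
         (\<lambda>u. h (restrict u ?N) + G1 u * lower_exp_irr par X M K x f)"
  proof (rule lower_exp_glued)
    fix u assume u: "u \<in> PiE ?N X"
    have "restrict u ?N' \<in> PiE ?N' X"
      by (rule restrict_in_PiE) (use PiE_mem[OF u] in \<open>auto simp: nondesc_nonpar_set_def\<close>)
    then show "0 \<le> G1 u" using g_nonneg by (simp add: G1_def)
    show "x t = u t" if "G1 u \<noteq> 0" "t \<in> ?PK" for t
      using that by (auto simp: G1_def split: if_splits)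
  qed
  moreover have "restrict (restrict z ?N) ?N = restrict z ?N" "restrict (restrict z ?N) ?N' = restrict z ?N'"
    "restrict (restrict z ?N) ?PK = restrict z ?PK" for z :: "'n \<Rightarrow> 'v"
    using PK_N by (auto simp: restrict_def fun_eq_iff nondesc_nonpar_set_def)
  ultimately show ?thesis by (simp add: G1_def)
qed

end
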